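(* Let $f\colon[0,1]\to[0,1]$. The following are equivalent: (i) $f$ is continuous and regular; (ii) $f$ can be computed by a nondeterministic finite-state transducer (with some fixed delay) for the standard binary representation; (iii) $f$ can be computed by a deterministic finite-state transducer (with some fixed delay) for the signed binary representation.
   Context: Standard binary representation: $\alpha\in\{0,1\}^\omega$ represents $\overline{\alpha}=\sum_s\alpha(s)2^{-s-1}\in[0,1]$. Signed binary representation: $\alpha\in\{-1,0,1\}^\omega$ represents $\sum_s\alpha(s)2^{-s-1}$; its representations of points of $[0,1]$ are all $\alpha$ with this value in $[0,1]$. A function $f\colon[0,1]\to[0,1]$ is regular if there is a nondeterministic Büchi automaton $A$ over $\{0,1\}$ such that for all $\alpha,\beta\in\{0,1\}^\omega$, $A$ accepts $\alpha(0)\beta(0)\alpha(1)\beta(1)\cdots$ (some run visits an accepting state infinitely often) iff $f(\overline{\alpha})=\overline{\beta}$. A finite-state transducer with delay $D$ has finitely many states, an initial state and a transition relation (a transition function if deterministic); it reads input symbols one at a time, writes nothing while reading the first $D$ input symbols (possibly changing state), and thereafter on reading each input symbol changes state and writes exactly one output symbol; in the nondeterministic case runs may die. It computes $f$ with respect to a representation (used for both input and output, with alphabet $\{0,1\}$ or $\{-1,0,1\}$ accordingly) if for every $x\in[0,1]$ and every representation $\alpha$ of $x$, there is an infinite run on $\alpha$ and every infinite run on $\alpha$ writes a representation of $f(x)$. *)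

theory Defs
  imports "HOL-Analysis.Analysis"
begin

definition binary_digits :: "int set" where
  "binary_digits = {0, 1}"

definition signed_digits :: "int set" where
  "signed_digits = {-1, 0, 1}"

definition word_value :: "(nat \<Rightarrow> int) \<Rightarrow> real" where
  "word_value \<alpha> = (\<Sum>s. real_of_int (\<alpha> s) / 2 ^ (s + 1))"

definition represents :: "int set \<Rightarrow> (nat \<Rightarrow> int) \<Rightarrow> real \<Rightarrow> bool" where
  "represents \<Sigma> \<alpha> x \<longleftrightarrow> range \<alpha> \<subseteq> \<Sigma> \<and> word_value \<alpha> = x"

record ('q, 'a) buchi =
  buchi_states :: "'q set"
  buchi_initial :: "'q set"
  buchi_trans :: "('q \<times> 'a \<times> 'q) set"
  buchi_accepting :: "'q set"

definition buchi_automaton :: "'a set \<Rightarrow> ('q, 'a) buchi \<Rightarrow> bool" where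
  "buchi_automaton \<Sigma> A \<longleftrightarrow>
     finite (buchi_states A) \<and>
     buchi_initial A \<subseteq> buchi_states A \<and>
     buchi_trans A \<subseteq> buchi_states A \<times> \<Sigma> \<times> buchi_states A \<and>
     buchi_accepting A \<subseteq> buchi_states A"

definition buchi_accepts :: "('q, 'a) buchi \<Rightarrow> (nat \<Rightarrow> 'a) \<Rightarrow> bool" where
  "buchi_accepts A w \<longleftrightarrow>
     (\<exists>q. q 0 \<in> buchi_initial A \<and>
          (\<forall>n. (q n, w n, q (Suc n)) \<in> buchi_trans A) \<and>
          (\<exists>\<^sub>\<infinity>n. q n \<in> buchi_accepting A))"

definition interleave :: "(nat \<Rightarrow> 'a) \<Rightarrow> (nat \<Rightarrow> 'a) \<Rightarrow> nat \<Rightarrow> 'a" where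
  "interleave \<alpha> \<beta> n = (if even n then \<alpha> (n div 2) else \<beta> (n div 2))"

text \<open>
  Here and below, machines have natural numbers as states. This loses no generality,
  since the state sets are finite.
\<close>

definition regular_function :: "(real \<Rightarrow> real) \<Rightarrow> bool" where
  "regular_function f \<longleftrightarrow>
     (\<exists>A :: (nat, int) buchi. buchi_automaton binary_digits A \<and>
        (\<forall>\<alpha> \<beta>. range \<alpha> \<subseteq> binary_digits \<longrightarrow> range \<beta> \<subseteq> binary_digits \<longrightarrow>
           (buchi_accepts A (interleave \<alpha> \<beta>) \<longleftrightarrow> f (word_value \<alpha>) = word_value \<beta>)))"

text \<open>
  A transition \<open>(q, a, b, q')\<close> reads \<open>a\<close> in state \<open>q\<close> and moves to \<open>q'\<close>; it writes nothing
  if \<open>b = None\<close> and the symbol \<open>c\<close> if \<open>b = Some c\<close>.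
\<close>

record ('q, 'a) transducer =
  td_states :: "'q set"
  td_initial :: "'q"
  td_trans :: "('q \<times> 'a \<times> 'a option \<times> 'q) set"

text \<open>
  The last conjunct is the delay condition. It concerns all finite runs, including
  those that die later: the transition reading the input symbol with index \<open>n\<close> writes
  nothing if \<open>n < D\<close>, and exactly one symbol otherwise.
\<close>

definition transducer_with_delay :: "'a set \<Rightarrow> nat \<Rightarrow> ('q, 'a) transducer \<Rightarrow> bool" where
  "transducer_with_delay \<Sigma> D T \<longleftrightarrow>
     finite (td_states T) \<and>
     td_initial T \<in> td_states T \<and>
     td_trans T \<subseteq> td_states T \<times> \<Sigma> \<times> insert None (Some ` \<Sigma>) \<times> td_states T \<and>
     (\<forall>q \<alpha> w n. q 0 = td_initial T \<longrightarrow>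
        (\<forall>i\<le>n. (q i, \<alpha> i, w i, q (Suc i)) \<in> td_trans T) \<longrightarrow>
        (w n = None \<longleftrightarrow> n < D))"

definition deterministic_transducer :: "'a set \<Rightarrow> ('q, 'a) transducer \<Rightarrow> bool" where
  "deterministic_transducer \<Sigma> T \<longleftrightarrow>
     (\<forall>q\<in>td_states T. \<forall>a\<in>\<Sigma>. \<exists>!p. (q, a, fst p, snd p) \<in> td_trans T)"

definition transducer_run ::
  "('q, 'a) transducer \<Rightarrow> (nat \<Rightarrow> 'a) \<Rightarrow> (nat \<Rightarrow> 'q) \<Rightarrow> (nat \<Rightarrow> 'a option) \<Rightarrow> bool" where
  "transducer_run T \<alpha> q w \<longleftrightarrow>
     q 0 = td_initial T \<and> (\<forall>n. (q n, \<alpha> n, w n, q (Suc n)) \<in> td_trans T)"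

definition writes :: "nat \<Rightarrow> (nat \<Rightarrow> 'a option) \<Rightarrow> (nat \<Rightarrow> 'a) \<Rightarrow> bool" where
  "writes D w \<beta> \<longleftrightarrow> (\<forall>n<D. w n = None) \<and> (\<forall>n. w (D + n) = Some (\<beta> n))"

definition computes :: "int set \<Rightarrow> nat \<Rightarrow> ('q, int) transducer \<Rightarrow> (real \<Rightarrow> real) \<Rightarrow> bool" where
  "computes \<Sigma> D T f \<longleftrightarrow>
     (\<forall>x\<in>{0..1}. \<forall>\<alpha>. represents \<Sigma> \<alpha> x \<longrightarrow>
        (\<exists>q w. transducer_run T \<alpha> q w) \<and>
        (\<forall>q w. transducer_run T \<alpha> q w \<longrightarrow>
           (\<exists>\<beta>. writes D w \<beta> \<and> represents \<Sigma> \<beta> (f x))))"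

definition nondet_computable :: "int set \<Rightarrow> (real \<Rightarrow> real) \<Rightarrow> bool" where
  "nondet_computable \<Sigma> f \<longleftrightarrow>
     (\<exists>D. \<exists>T :: (nat, int) transducer. transducer_with_delay \<Sigma> D T \<and> computes \<Sigma> D T f)"

definition det_computable :: "int set \<Rightarrow> (real \<Rightarrow> real) \<Rightarrow> bool" where
  "det_computable \<Sigma> f \<longleftrightarrow>
     (\<exists>D. \<exists>T :: (nat, int) transducer.
        transducer_with_delay \<Sigma> D T \<and> deterministic_transducer \<Sigma> T \<and> computes \<Sigma> D T f)"

end

theory Submission imports Defs begin

text \<open>
  Suppose \<open>f\<close> is continuous and regular, and rescale the part of its graph in each dyadic square of
  side \<open>1 / 2 ^ n\<close> to the unit square. The result is determined by the set of states that the
  automaton reaches on the two prefixes, so only finitely many sets arise. For a fixed dyadic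
  interval, the nonempty sets of different squares above it are disjoint, hence different, so \<open>f\<close>
  meets a bounded number of these squares and, being continuous, varies on the interval by at most
  a constant multiple of \<open>1 / 2 ^ n\<close>. If \<open>2 ^ D\<close> exceeds this constant, a delay of \<open>D\<close> digits
  provides enough information to choose the next signed output digit, and the part of the graph that is
  still relevant, rescaled, is a state from a finite set.

  A signed output is turned into a binary one by guessing the binary digits and keeping the
  difference of the two prefix values bounded. For a nondeterministic binary transducer, the same
  bounded difference yields an automaton for the graph of \<open>f\<close>, and compactness of the space of runs
  shows that the graph is closed, whence \<open>f\<close> is continuous.
\<close>

section \<open>Values of digit words\<close>

text \<open>This is the numerator over \<open>2 ^ n\<close> of the \<open>n\<close>-th partial sum
  of \<open>word_value\<close>. Keeping it integral lets differences of prefixes serve as registers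
  of finite machines.\<close>

primrec prefix_value :: "(nat \<Rightarrow> int) \<Rightarrow> nat \<Rightarrow> int" where
  "prefix_value \<alpha> 0 = 0"
| "prefix_value \<alpha> (Suc n) = 2 * prefix_value \<alpha> n + \<alpha> n"

lemma prefix_value_cong:
  "(\<And>i. i < n \<Longrightarrow> \<alpha> i = \<beta> i) \<Longrightarrow> prefix_value \<alpha> n = prefix_value \<beta> n"
  by (induction n) auto

lemma binary_subset_signed: "binary_digits \<subseteq> signed_digits"
  by (auto simp: binary_digits_def signed_digits_def)

lemma signed_digit_abs_le: "range \<alpha> \<subseteq> signed_digits \<Longrightarrow> \<bar>\<alpha> n\<bar> \<le> 1"
  by (auto simp: signed_digits_def dest!: subsetD[OF _ rangeI, of _ _ n])

lemma signed_digit_term_le: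
  "range \<alpha> \<subseteq> signed_digits \<Longrightarrow> norm (real_of_int (\<alpha> s) / 2 ^ (s + 1)) \<le> (1 / 2) ^ Suc s"
  using signed_digit_abs_le[of \<alpha> s] by (simp add: power_divide divide_simps)

lemma signed_word_summable:
  "range \<alpha> \<subseteq> signed_digits \<Longrightarrow> summable (\<lambda>s. real_of_int (\<alpha> s) / 2 ^ (s + 1))"
  by (rule summable_comparison_test'[OF sums_summable[OF power_half_series]])
     (use signed_digit_term_le in blast)

lemma word_value_abs_le_1:
  assumes "range \<alpha> \<subseteq> signed_digits"
  shows "\<bar>word_value \<alpha>\<bar> \<le> 1"
proof -
  have "norm (\<Sum>s. real_of_int (\<alpha> s) / 2 ^ (s + 1)) \<le> (\<Sum>s. (1 / 2 :: real) ^ Suc s)"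
    by (rule norm_suminf_le[OF signed_digit_term_le[OF assms]])
       (rule sums_summable[OF power_half_series])
  also have "\<dots> = 1"
    using power_half_series by (rule sums_unique[symmetric])
  finally show ?thesis
    by (simp add: word_value_def)
qed

lemma word_value_binary:
  assumes "range \<alpha> \<subseteq> binary_digits"
  shows "word_value \<alpha> \<in> {0..1}"
proof -
  have s: "range \<alpha> \<subseteq> signed_digits"
    using assms binary_subset_signed by blast
  have "\<alpha> n \<ge> 0" for n
    using assms by (auto simp: binary_digits_def dest!: subsetD[OF _ rangeI, of _ _ n])
  then have "0 \<le> word_value \<alpha>"
    unfolding word_value_def by (intro suminf_nonneg signed_word_summable s) simp
  with word_value_abs_le_1[OF s] show ?thesis
    by auto
qed

lemma word_value_step:
  assumes "range \<alpha> \<subseteq> signed_digits"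
  shows "word_value \<alpha> = (\<alpha> 0 + word_value (\<lambda>i. \<alpha> (Suc i))) / 2"
proof -
  have "range (\<lambda>i. \<alpha> (Suc i)) \<subseteq> signed_digits"
    using assms by auto
  note s = signed_word_summable[OF this]
  have "word_value \<alpha> = \<alpha> 0 / 2 + (\<Sum>s. real_of_int (\<alpha> (Suc s)) / 2 ^ (Suc s + 1))"
    using suminf_split_head[OF signed_word_summable[OF assms]] by (simp add: word_value_def)
  also have "(\<Sum>s. real_of_int (\<alpha> (Suc s)) / 2 ^ (Suc s + 1))
      = (\<Sum>s. real_of_int (\<alpha> (Suc s)) / 2 ^ (s + 1) / 2)"
    by (intro suminf_cong) simp
  also have "\<dots> = word_value (\<lambda>i. \<alpha> (Suc i)) / 2"
    unfolding word_value_def by (rule suminf_divide[OF s])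
  finally show ?thesis
    by (simp add: field_simps)
qed

lemma word_value_split:
  assumes "range \<alpha> \<subseteq> signed_digits"
  shows "2 ^ n * word_value \<alpha> = prefix_value \<alpha> n + word_value (\<lambda>i. \<alpha> (i + n))"
proof (induction n)
  case (Suc n)
  have "range (\<lambda>i. \<alpha> (i + n)) \<subseteq> signed_digits"
    using assms by auto
  from word_value_step[OF this] Suc show ?case
    by (simp add: algebra_simps)
qed simp

text \<open>What remains after \<open>n\<close> digits is again a signed word, whose value lies
  between -1 and 1. All register bounds below rest on this.\<close>

lemma prefix_value_approx:
  assumes "range \<alpha> \<subseteq> signed_digits"
  shows "\<bar>2 ^ n * word_value \<alpha> - prefix_value \<alpha> n\<bar> \<le> 1"
proof -
  have "range (\<lambda>i. \<alpha> (i + n)) \<subseteq> signed_digits"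
    using assms by auto
  from word_value_abs_le_1[OF this] word_value_split[OF assms, of n] show ?thesis
    by simp
qed

lemma prefix_value_approx_scaled:
  assumes "range \<alpha> \<subseteq> signed_digits"
  shows "\<bar>2 ^ (D + n) * word_value \<alpha> - 2 ^ D * prefix_value \<alpha> n\<bar> \<le> 2 ^ D"
proof -
  have "2 ^ (D + n) * word_value \<alpha> - 2 ^ D * prefix_value \<alpha> n
      = 2 ^ D * (2 ^ n * word_value \<alpha> - prefix_value \<alpha> n)"
    by (simp add: power_add algebra_simps)
  then show ?thesis
    using prefix_value_approx[OF assms, of n] by (simp add: abs_mult)
qed

text \<open>A nonzero difference doubles with every \<open>n\<close> and would outgrow
  \<open>C\<close>. The threshold \<open>N\<close> admits bounds that hold only once a delay has
  passed.\<close>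

lemma eq_if_power_two_diff_bounded:
  fixes x y :: real
  assumes "\<And>n. n \<ge> N \<Longrightarrow> \<bar>2 ^ n * x - 2 ^ n * y\<bar> \<le> C"
  shows "x = y"
proof (rule ccontr)
  assume "x \<noteq> y"
  then obtain n where n: "C / \<bar>x - y\<bar> < 2 ^ n"
    using real_arch_pow[of 2 "C / \<bar>x - y\<bar>"] by auto
  have "C < 2 ^ n * \<bar>x - y\<bar>"
    using n \<open>x \<noteq> y\<close> by (simp add: field_simps)
  \<comment> \<open>The index is raised to at least \<open>N\<close>, where the assumed bound is
    available.\<close>
  also have "\<dots> \<le> 2 ^ max n N * \<bar>x - y\<bar>"
    by (intro mult_right_mono power_increasing) auto
  also have "\<dots> = \<bar>2 ^ max n N * x - 2 ^ max n N * y\<bar>"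
    by (simp add: abs_mult flip: right_diff_distrib)
  also have "\<dots> \<le> C"
    by (rule assms) simp
  finally show False
    by simp
qed

lemma word_value_eqI:
  fixes x C :: real
  assumes "range \<alpha> \<subseteq> signed_digits" "\<And>n. \<bar>2 ^ n * x - prefix_value \<alpha> n\<bar> \<le> C"
  shows "word_value \<alpha> = x"
proof (rule eq_if_power_two_diff_bounded[where N = 0 and C = "C + 1"])
  fix n :: nat
  show "\<bar>2 ^ n * word_value \<alpha> - 2 ^ n * x\<bar> \<le> C + 1"
    using prefix_value_approx[OF assms(1), of n] assms(2)[of n] by linarith
qed

lemma word_value_eq_if_prefix_diff_bounded:
  assumes "range \<alpha> \<subseteq> signed_digits" "range \<beta> \<subseteq> signed_digits"
    and "\<And>n. \<bar>prefix_value \<alpha> n - prefix_value \<beta> n\<bar> \<le> C"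
  shows "word_value \<alpha> = word_value \<beta>"
proof (rule word_value_eqI[where C = "C + 1", OF assms(1)])
  fix n
  have "\<bar>real_of_int (prefix_value \<alpha> n - prefix_value \<beta> n)\<bar> \<le> C"
    using assms(3)[of n] by linarith
  then show "\<bar>2 ^ n * word_value \<beta> - prefix_value \<alpha> n\<bar> \<le> real_of_int (C + 1)"
    using prefix_value_approx[OF assms(2), of n] by simp
qed

text \<open>Both scaled values lie within 1 of the same integer, the value of the common
  prefix.\<close>

lemma word_value_diff_le_if_prefix_eq:
  assumes "range \<alpha> \<subseteq> signed_digits" "range \<beta> \<subseteq> signed_digits"
    and "\<And>i. i < n \<Longrightarrow> \<alpha> i = \<beta> i"
  shows "\<bar>2 ^ n * word_value \<alpha> - 2 ^ n * word_value \<beta>\<bar> \<le> 2"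
  using prefix_value_approx[OF assms(1), of n] prefix_value_approx[OF assms(2), of n]
    prefix_value_cong[OF assms(3)] by auto

section \<open>Existence of binary words\<close>

lemma ex_binary_representation:
  assumes "x \<in> {0..1}"
  obtains \<alpha> where "represents binary_digits \<alpha> x"
proof (cases "x = 1")
  \<comment> \<open>The floor digits of the other case need \<lfloor>x\<rfloor> = 0, so 1 is
    represented by the word of all ones instead.\<close>
  case True
  let ?\<alpha> = "\<lambda>_ :: nat. 1 :: int"
  have "prefix_value ?\<alpha> n = 2 ^ n - 1" for n
    by (induction n) auto
  then have "word_value ?\<alpha> = x"
    by (intro word_value_eqI[where C = 1]) (auto simp: True signed_digits_def)
  then show ?thesis
    using that[of ?\<alpha>] by (simp add: represents_def binary_digits_def)
next
  case False
  \<comment> \<open>The digits are chosen so that the prefix values become the floors of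
    \<open>2 ^ n * x\<close>.\<close>
  define \<alpha> where "\<alpha> n = \<lfloor>2 ^ Suc n * x\<rfloor> - 2 * \<lfloor>2 ^ n * x\<rfloor>" for n
  have digit: "\<lfloor>2 * y\<rfloor> - 2 * \<lfloor>y\<rfloor> = 0 \<or> \<lfloor>2 * y\<rfloor> - 2 * \<lfloor>y\<rfloor> = 1" for y :: real
    by linarith
  have "\<alpha> n \<in> binary_digits" for n
    using digit[of "2 ^ n * x"] by (auto simp: \<alpha>_def binary_digits_def mult.assoc)
  then have r: "range \<alpha> \<subseteq> binary_digits"
    by auto
  have "\<lfloor>x\<rfloor> = 0"
    using assms False by (simp add: floor_eq_iff)
  then have "prefix_value \<alpha> n = \<lfloor>2 ^ n * x\<rfloor>" for n
    by (induction n) (auto simp: \<alpha>_def)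
  then have "\<bar>2 ^ n * x - prefix_value \<alpha> n\<bar> \<le> 1" for n
    by simp linarith
  then have "word_value \<alpha> = x"
    using r binary_subset_signed by (intro word_value_eqI[where C = 1]) auto
  with r show ?thesis
    using that[of \<alpha>] by (simp add: represents_def)
qed

lemma ex_binary_prefix:
  assumes "0 \<le> k" "k < 2 ^ n"
  shows "\<exists>u. range u \<subseteq> binary_digits \<and> prefix_value u n = k"
  using assms
proof (induction n arbitrary: k)
  case 0
  then show ?case
    by (intro exI[of _ "\<lambda>_. 0"]) (auto simp: binary_digits_def)
next
  case (Suc n)
  then have "0 \<le> k div 2" "k div 2 < 2 ^ n"
    by auto
  with Suc.IH obtain u where u: "range u \<subseteq> binary_digits" "prefix_value u n = k div 2"
    by blast
  \<comment> \<open>The last digit is the parity of \<open>k\<close>; the digits before it encode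
    \<open>k div 2\<close>.\<close>
  let ?u = "u(n := k mod 2)"
  have "prefix_value ?u n = k div 2"
    using prefix_value_cong[of n ?u u] u(2) by simp
  then have "prefix_value ?u (Suc n) = k"
    by simp
  moreover have "range ?u \<subseteq> binary_digits"
    using u(1) by (auto simp: binary_digits_def)
  ultimately show ?case
    by blast
qed

text \<open>This is compactness of the space of words over a finite alphabet, proved by repeated use
  of the pigeonhole principle.\<close>

lemma pointwise_limit_of_words:
  fixes g :: "nat \<Rightarrow> nat \<Rightarrow> 'a"
  assumes "finite A" "\<And>k i. g k i \<in> A"
  obtains l where "\<And>n. \<exists>\<^sub>\<infinity>k. \<forall>i<n. g k i = l i"
proof -
  have step: "\<exists>a. infinite {k \<in> K. g k n = a}" if "infinite K" for K n
    using pigeonhole_infinite[OF that, of "\<lambda>k. g k n"] finite_subset[OF _ assms(1)] assms(2)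
    by (metis (no_types, lifting) image_subsetI Collect_cong)
  \<comment> \<open>The sets \<open>K n\<close> decrease and stay infinite: passing from
    \<open>K n\<close> to \<open>K (Suc n)\<close> fixes the letter at position \<open>n\<close> to
    a value taken infinitely often.\<close>
  define K where "K = rec_nat UNIV (\<lambda>n K. {k \<in> K. g k n = (SOME a. infinite {k \<in> K. g k n = a})})"
  define l where "l n = (SOME a. infinite {k \<in> K n. g k n = a})" for n
  have K_Suc: "K (Suc n) = {k \<in> K n. g k n = l n}" for n
    by (simp add: K_def l_def)
  have "infinite (K n)" for n
  proof (induction n)
    case 0
    then show ?case by (simp add: K_def)
  next
    case (Suc n)
    from someI_ex[OF step[OF this, of n]] show ?case
      by (simp add: K_Suc l_def)
  qed
  moreover have "K n \<subseteq> {k. \<forall>i<n. g k i = l i}" for n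
    by (induction n) (auto simp: K_Suc less_Suc_eq)
  ultimately have "\<exists>\<^sub>\<infinity>k. \<forall>i<n. g k i = l i" for n
    unfolding INFM_iff_infinite by (rule infinite_super[rotated])
  then show thesis
    by (rule that)
qed

section \<open>Renaming of states\<close>

lemma transducer_delay:
  assumes "transducer_with_delay \<Sigma> D T" "q 0 = td_initial T"
    and "\<And>i. i \<le> n \<Longrightarrow> (q i, \<alpha> i, w i, q (Suc i)) \<in> td_trans T"
  shows "w n = None \<longleftrightarrow> n < D"
  using assms unfolding transducer_with_delay_def by blast

lemma computes_ex_run:
  assumes "computes \<Sigma> D T f" "x \<in> {0..1}" "represents \<Sigma> \<alpha> x"
  obtains q w where "transducer_run T \<alpha> q w"
  using assms unfolding computes_def by blast

lemma computes_output:
  assumes "computes \<Sigma> D T f" "x \<in> {0..1}" "represents \<Sigma> \<alpha> x" "transducer_run T \<alpha> q w"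
  obtains \<beta> where "writes D w \<beta>" "represents \<Sigma> \<beta> (f x)"
  using assms unfolding computes_def by blast

text \<open>Computability asks for natural numbers as states, whereas the constructions below use
  tuples and sets; the states are transported along an injection.\<close>

definition map_transducer :: "('q \<Rightarrow> 'p) \<Rightarrow> ('q, 'a) transducer \<Rightarrow> ('p, 'a) transducer" where
  "map_transducer h T = \<lparr>td_states = h ` td_states T, td_initial = h (td_initial T),
     td_trans = (\<lambda>(q, a, b, q'). (h q, a, b, h q')) ` td_trans T\<rparr>"

lemma map_transducer_initial: "td_initial (map_transducer h T) = h (td_initial T)"
  by (simp add: map_transducer_def)

lemma map_transducer_trans:
  "(q, a, b, q') \<in> td_trans T \<Longrightarrow> (h q, a, b, h q') \<in> td_trans (map_transducer h T)"
  by (force simp: map_transducer_def)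

lemma map_transducer_trans_inv:
  assumes "transducer_with_delay \<Sigma> D T" "inj_on h (td_states T)"
    and "(p, a, b, p') \<in> td_trans (map_transducer h T)"
  shows "(the_inv_into (td_states T) h p, a, b, the_inv_into (td_states T) h p') \<in> td_trans T"
  using assms
  by (fastforce simp: map_transducer_def transducer_with_delay_def the_inv_into_f_f)

lemma map_transducer_with_delay:
  assumes T: "transducer_with_delay \<Sigma> D T" and h: "inj_on h (td_states T)"
  shows "transducer_with_delay \<Sigma> D (map_transducer h T)"
  unfolding transducer_with_delay_def
proof (intro conjI allI impI)
  fix q \<alpha> w and n :: nat
  let ?g = "the_inv_into (td_states T) h"
  assume "q 0 = td_initial (map_transducer h T)"
    and run: "\<forall>i\<le>n. (q i, \<alpha> i, w i, q (Suc i)) \<in> td_trans (map_transducer h T)"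
  then have "?g (q 0) = td_initial T"
    using T h by (simp add: map_transducer_def transducer_with_delay_def the_inv_into_f_f)
  moreover have "(?g (q i), \<alpha> i, w i, ?g (q (Suc i))) \<in> td_trans T" if "i \<le> n" for i
    using that run map_transducer_trans_inv[OF T h] by blast
  ultimately show "w n = None \<longleftrightarrow> n < D"
    by (rule transducer_delay[OF T, of "\<lambda>i. ?g (q i)"])
qed (use T in \<open>auto simp: map_transducer_def transducer_with_delay_def\<close>)

text \<open>Injectivity prevents the renaming from merging two states and so giving one state two
  moves on the same digit.\<close>

lemma map_transducer_deterministic:
  assumes T: "transducer_with_delay \<Sigma> D T" and h: "inj_on h (td_states T)"
    and det: "deterministic_transducer \<Sigma> T"
  shows "deterministic_transducer \<Sigma> (map_transducer h T)"
  unfolding deterministic_transducer_def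
proof (intro ballI)
  fix p a
  assume "p \<in> td_states (map_transducer h T)" "a \<in> \<Sigma>"
  then obtain q where q: "q \<in> td_states T" "p = h q"
    by (auto simp: map_transducer_def)
  from det q(1) \<open>a \<in> \<Sigma>\<close> obtain b r where br: "(q, a, b, r) \<in> td_trans T"
    and uniq: "\<And>b' r'. (q, a, b', r') \<in> td_trans T \<Longrightarrow> b' = b \<and> r' = r"
    unfolding deterministic_transducer_def by (metis fst_conv snd_conv)
  show "\<exists>!s. (p, a, fst s, snd s) \<in> td_trans (map_transducer h T)"
  proof (rule ex1I[of _ "(b, h r)"])
    show "(p, a, fst (b, h r), snd (b, h r)) \<in> td_trans (map_transducer h T)"
      using map_transducer_trans[OF br] q by simp
  next
    fix s
    assume "(p, a, fst s, snd s) \<in> td_trans (map_transducer h T)"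
    then obtain q1 r1 where s: "(q1, a, fst s, r1) \<in> td_trans T" "p = h q1" "snd s = h r1"
      by (auto simp: map_transducer_def)
    moreover have "q1 \<in> td_states T"
      using s(1) T by (auto simp: transducer_with_delay_def)
    ultimately have "q1 = q"
      using q h by (auto dest: inj_onD)
    with s uniq show "s = (b, h r)"
      by (metis prod.collapse)
  qed
qed

lemma map_transducer_computes:
  assumes T: "transducer_with_delay \<Sigma> D T" and h: "inj_on h (td_states T)"
    and c: "computes \<Sigma> D T f"
  shows "computes \<Sigma> D (map_transducer h T) f"
  unfolding computes_def
proof (intro ballI allI impI conjI)
  fix x :: real and \<alpha>
  assume x: "x \<in> {0..1}" "represents \<Sigma> \<alpha> x"
  then obtain q w where "transducer_run T \<alpha> q w"
    by (rule computes_ex_run[OF c])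
  then have "transducer_run (map_transducer h T) \<alpha> (h \<circ> q) w"
    by (auto simp: transducer_run_def map_transducer_initial intro: map_transducer_trans)
  then show "\<exists>q w. transducer_run (map_transducer h T) \<alpha> q w"
    by blast
  fix q w
  assume run: "transducer_run (map_transducer h T) \<alpha> q w"
  have "transducer_run T \<alpha> (the_inv_into (td_states T) h \<circ> q) w"
    using run T h map_transducer_trans_inv[OF T h]
    by (auto simp: transducer_run_def map_transducer_initial transducer_with_delay_def
        the_inv_into_f_f)
  from computes_output[OF c x this] show "\<exists>\<beta>. writes D w \<beta> \<and> represents \<Sigma> \<beta> (f x)"
    by blast
qed

lemma ex_nat_inj_on:
  assumes "finite A"
  obtains h :: "'a \<Rightarrow> nat" where "inj_on h A"
  using finite_imp_inj_to_nat_seg[OF assms] by blast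

lemma nondet_computableI:
  assumes "transducer_with_delay \<Sigma> D T" "computes \<Sigma> D T f"
  shows "nondet_computable \<Sigma> f"
proof -
  have "finite (td_states T)"
    using assms(1) by (simp add: transducer_with_delay_def)
  then obtain h :: "_ \<Rightarrow> nat" where "inj_on h (td_states T)"
    by (rule ex_nat_inj_on)
  with assms show ?thesis
    unfolding nondet_computable_def
    by (blast intro: map_transducer_with_delay map_transducer_computes)
qed

lemma det_computableI:
  assumes "transducer_with_delay \<Sigma> D T" "deterministic_transducer \<Sigma> T" "computes \<Sigma> D T f"
  shows "det_computable \<Sigma> f"
proof -
  have "finite (td_states T)"
    using assms(1) by (simp add: transducer_with_delay_def)
  then obtain h :: "_ \<Rightarrow> nat" where "inj_on h (td_states T)"
    by (rule ex_nat_inj_on)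
  with assms show ?thesis
    unfolding det_computable_def
    by (blast intro: map_transducer_with_delay map_transducer_deterministic map_transducer_computes)
qed

section \<open>Renaming of states of Buchi automata\<close>

definition map_buchi :: "('q \<Rightarrow> 'p) \<Rightarrow> ('q, 'a) buchi \<Rightarrow> ('p, 'a) buchi" where
  "map_buchi h A = \<lparr>buchi_states = h ` buchi_states A, buchi_initial = h ` buchi_initial A,
     buchi_trans = (\<lambda>(q, a, q'). (h q, a, h q')) ` buchi_trans A,
     buchi_accepting = h ` buchi_accepting A\<rparr>"

lemma map_buchi_automaton:
  "buchi_automaton \<Sigma> A \<Longrightarrow> buchi_automaton \<Sigma> (map_buchi h A)"
  by (auto simp: buchi_automaton_def map_buchi_def)

lemma map_buchi_accepts:
  assumes A: "buchi_automaton \<Sigma> A" and h: "inj_on h (buchi_states A)"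
  shows "buchi_accepts (map_buchi h A) w \<longleftrightarrow> buchi_accepts A w"
proof
  assume "buchi_accepts A w"
  then obtain q where q: "q 0 \<in> buchi_initial A" "\<forall>n. (q n, w n, q (Suc n)) \<in> buchi_trans A"
    "\<exists>\<^sub>\<infinity>n. q n \<in> buchi_accepting A"
    by (auto simp: buchi_accepts_def)
  have "\<forall>n. (h (q n), w n, h (q (Suc n))) \<in> buchi_trans (map_buchi h A)"
    using q(2) by (force simp: map_buchi_def)
  moreover have "\<exists>\<^sub>\<infinity>n. h (q n) \<in> buchi_accepting (map_buchi h A)"
    using q(3) by (rule INFM_mono) (simp add: map_buchi_def)
  ultimately show "buchi_accepts (map_buchi h A) w"
    using q(1) unfolding buchi_accepts_def
    by (intro exI[of _ "\<lambda>n. h (q n)"]) (simp add: map_buchi_def)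
next
  let ?g = "the_inv_into (buchi_states A) h"
  have g: "?g (h q) = q" if "q \<in> buchi_states A" for q
    using that h by (simp add: the_inv_into_f_f)
  assume "buchi_accepts (map_buchi h A) w"
  then obtain q where q: "q 0 \<in> h ` buchi_initial A"
    "\<And>n. (q n, w n, q (Suc n)) \<in> (\<lambda>(q, a, q'). (h q, a, h q')) ` buchi_trans A"
    "\<exists>\<^sub>\<infinity>n. q n \<in> h ` buchi_accepting A"
    by (auto simp: buchi_accepts_def map_buchi_def)
  have "?g (q 0) \<in> buchi_initial A"
    using q(1) A g by (auto simp: buchi_automaton_def dest: subsetD)
  moreover have "(?g (q n), w n, ?g (q (Suc n))) \<in> buchi_trans A" for n
    using q(2)[of n] A g by (fastforce simp: buchi_automaton_def)
  moreover have "\<exists>\<^sub>\<infinity>n. ?g (q n) \<in> buchi_accepting A"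
    using q(3) by (rule INFM_mono) (use A g in \<open>auto simp: buchi_automaton_def dest: subsetD\<close>)
  ultimately show "buchi_accepts A w"
    unfolding buchi_accepts_def by (intro exI[of _ "\<lambda>n. ?g (q n)"]) blast
qed

lemma regular_functionI:
  assumes A: "buchi_automaton binary_digits A"
    and acc: "\<And>\<alpha> \<beta>. range \<alpha> \<subseteq> binary_digits \<Longrightarrow> range \<beta> \<subseteq> binary_digits \<Longrightarrow>
      buchi_accepts A (interleave \<alpha> \<beta>) \<longleftrightarrow> f (word_value \<alpha>) = word_value \<beta>"
  shows "regular_function f"
proof -
  have "finite (buchi_states A)"
    using A by (simp add: buchi_automaton_def)
  then obtain h :: "_ \<Rightarrow> nat" where h: "inj_on h (buchi_states A)"
    by (rule ex_nat_inj_on)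
  show ?thesis
    unfolding regular_function_def
    using map_buchi_automaton[OF A] map_buchi_accepts[OF A h] acc
    by (intro exI[of _ "map_buchi h A"]) simp
qed

section \<open>From signed to binary output\<close>

text \<open>
  The converter guesses binary output digits \<open>b\<close> for the signed output digits \<open>c\<close>; its
  register \<open>d\<close> is the difference of the prefix values of both outputs, which stays bounded
  iff they represent the same number.
\<close>

definition binary_output :: "('q, int) transducer \<Rightarrow> ('q \<times> int, int) transducer" where
  "binary_output T = \<lparr>td_states = td_states T \<times> {-2..2}, td_initial = (td_initial T, 0),
     td_trans =
       {((q, d), a, None, (q', d)) | q d a q'.
          (q, a, None, q') \<in> td_trans T \<and> a \<in> binary_digits \<and> d \<in> {-2..2}} \<union>
       {((q, d), a, Some b, (q', 2 * d + c - b)) | q d a b c q'.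
          (q, a, Some c, q') \<in> td_trans T \<and> a \<in> binary_digits \<and> b \<in> binary_digits \<and>
          d \<in> {-2..2} \<and> 2 * d + c - b \<in> {-2..2}}\<rparr>"

lemma binary_output_writeI:
  assumes "(q, a, Some c, q') \<in> td_trans T" "a \<in> binary_digits" "b \<in> binary_digits"
    and "d \<in> {-2..2}" "d' = 2 * d + c - b" "d' \<in> {-2..2}"
  shows "((q, d), a, Some b, (q', d')) \<in> td_trans (binary_output T)"
  using assms by (auto simp: binary_output_def)

lemma binary_output_transE:
  assumes "(r, a, w, r') \<in> td_trans (binary_output T)"
  obtains v where "(fst r, a, v, fst r') \<in> td_trans T" "v = None \<longleftrightarrow> w = None"
    "\<bar>snd r'\<bar> \<le> 2" "w = None \<Longrightarrow> snd r' = snd r"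
    "w \<noteq> None \<Longrightarrow> the w \<in> binary_digits \<and> snd r' = 2 * snd r + the v - the w"
  using assms unfolding binary_output_def by force

lemma binary_output_with_delay:
  assumes T: "transducer_with_delay signed_digits D T"
  shows "transducer_with_delay binary_digits D (binary_output T)"
  unfolding transducer_with_delay_def
proof (intro conjI allI impI)
  fix r \<alpha> w and n :: nat
  assume init: "r 0 = td_initial (binary_output T)"
    and run: "\<forall>i\<le>n. (r i, \<alpha> i, w i, r (Suc i)) \<in> td_trans (binary_output T)"
  \<comment> \<open>Forgetting the register leaves a run of \<open>T\<close> that writes at exactly
    the same positions.\<close>
  have "\<exists>v. i \<le> n \<longrightarrow> (fst (r i), \<alpha> i, v, fst (r (Suc i))) \<in> td_trans T \<and> (v = None \<longleftrightarrow> w i = None)"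
    for i
    using run by (metis binary_output_transE)
  then obtain v where v: "i \<le> n \<Longrightarrow> (fst (r i), \<alpha> i, v i, fst (r (Suc i))) \<in> td_trans T"
    "i \<le> n \<Longrightarrow> v i = None \<longleftrightarrow> w i = None" for i
    by metis
  have "v n = None \<longleftrightarrow> n < D"
    using transducer_delay[OF T, of "\<lambda>i. fst (r i)" n \<alpha> v] v(1) init
    by (simp add: binary_output_def)
  with v(2)[of n] show "w n = None \<longleftrightarrow> n < D"
    by simp
qed (use T in \<open>auto simp: binary_output_def transducer_with_delay_def\<close>)

lemma writesD: "writes D w \<beta> \<Longrightarrow> w n = (if n < D then None else Some (\<beta> (n - D)))"
  unfolding writes_def by (metis add_diff_inverse_nat)

text \<open>Every binary representation of the value \<open>y\<close> written by \<open>T\<close>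
  can be guessed successfully, since its prefixes stay close to those of the signed output.\<close>

lemma binary_output_run_exists:
  assumes run: "transducer_run T \<alpha> q w" and w: "writes D w \<gamma>"
    and \<alpha>: "range \<alpha> \<subseteq> binary_digits"
    and \<gamma>: "represents signed_digits \<gamma> y" and \<beta>: "represents binary_digits \<beta> y"
  shows "\<exists>r v. transducer_run (binary_output T) \<alpha> r v"
proof -
  \<comment> \<open>Truncated subtraction keeps the register at 0 as long as nothing is
    written.\<close>
  define d where "d n = prefix_value \<gamma> (n - D) - prefix_value \<beta> (n - D)" for n
  define v where "v n = (if n < D then None else Some (\<beta> (n - D)))" for n
  have "range \<beta> \<subseteq> signed_digits"
    using \<beta> binary_subset_signed by (auto simp: represents_def)
  \<comment> \<open>Both prefix values are within 1 of \<open>2 ^ (n - D) * y\<close>; this is where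
    the register bound 2 comes from.\<close>
  then have d: "d n \<in> {-2..2}" for n
    using \<beta> \<gamma> prefix_value_approx[of \<gamma> "n - D"] prefix_value_approx[of \<beta> "n - D"]
    unfolding d_def represents_def atLeastAtMost_iff by simp linarith
  have "((q n, d n), \<alpha> n, v n, (q (Suc n), d (Suc n))) \<in> td_trans (binary_output T)" for n
  proof (cases "n < D")
    case True
    then have "d (Suc n) = d n"
      by (simp add: d_def)
    moreover have "(q n, \<alpha> n, None, q (Suc n)) \<in> td_trans T"
      using run True by (metis transducer_run_def writesD[OF w])
    ultimately show ?thesis
      using True d[of n] \<alpha> by (auto simp: v_def binary_output_def)
  next
    case False
    then have "d (Suc n) = 2 * d n + \<gamma> (n - D) - \<beta> (n - D)"
      by (simp add: d_def Suc_diff_le)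
    moreover have "(q n, \<alpha> n, Some (\<gamma> (n - D)), q (Suc n)) \<in> td_trans T"
      using run False by (metis transducer_run_def writesD[OF w])
    moreover have "\<beta> (n - D) \<in> binary_digits" "\<alpha> n \<in> binary_digits"
      using \<alpha> \<beta> by (auto simp: represents_def)
    ultimately show ?thesis
      using False d[of n] d[of "Suc n"] by (auto simp: v_def intro!: binary_output_writeI)
  qed
  then have "transducer_run (binary_output T) \<alpha> (\<lambda>n. (q n, d n)) v"
    using run by (auto simp: transducer_run_def binary_output_def d_def)
  then show ?thesis
    by blast
qed

text \<open>A run exists because \<open>f x\<close> lies in the unit interval and so has a binary
  representation to guess. Conversely, an infinite run projects to a run of \<open>T\<close>, and
  the bounded register forces both outputs to have the same value.\<close>

lemma binary_output_computes:
  assumes c: "computes signed_digits D T f" and f: "f ` {0..1} \<subseteq> {0..1}"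
  shows "computes binary_digits D (binary_output T) f"
  unfolding computes_def
proof (intro ballI allI impI conjI)
  fix x :: real and \<alpha>
  assume x: "x \<in> {0..1}" and \<alpha>: "represents binary_digits \<alpha> x"
  then have \<alpha>': "represents signed_digits \<alpha> x"
    using binary_subset_signed by (auto simp: represents_def)
  obtain q w where run: "transducer_run T \<alpha> q w"
    using computes_ex_run[OF c x \<alpha>'] .
  obtain \<gamma> where "writes D w \<gamma>" "represents signed_digits \<gamma> (f x)"
    using computes_output[OF c x \<alpha>' run] .
  moreover obtain \<beta> where "represents binary_digits \<beta> (f x)"
    using ex_binary_representation f x by blast
  ultimately show "\<exists>q w. transducer_run (binary_output T) \<alpha> q w"
    using binary_output_run_exists[OF run] \<alpha> by (auto simp: represents_def)
next
  fix x :: real and \<alpha> r w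
  assume x: "x \<in> {0..1}" and \<alpha>: "represents binary_digits \<alpha> x"
    and run: "transducer_run (binary_output T) \<alpha> r w"
  then have \<alpha>': "represents signed_digits \<alpha> x"
    using binary_subset_signed by (auto simp: represents_def)
  have "\<forall>n. \<exists>v. (fst (r n), \<alpha> n, v, fst (r (Suc n))) \<in> td_trans T \<and> (v = None \<longleftrightarrow> w n = None) \<and>
      \<bar>snd (r (Suc n))\<bar> \<le> 2 \<and> (w n = None \<longrightarrow> snd (r (Suc n)) = snd (r n)) \<and>
      (w n \<noteq> None \<longrightarrow> the (w n) \<in> binary_digits \<and>
         snd (r (Suc n)) = 2 * snd (r n) + the v - the (w n))"
    using run unfolding transducer_run_def by (metis binary_output_transE)
  then obtain v where v: "\<And>n. (fst (r n), \<alpha> n, v n, fst (r (Suc n))) \<in> td_trans T"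
    "\<And>n. v n = None \<longleftrightarrow> w n = None" "\<And>n. \<bar>snd (r (Suc n))\<bar> \<le> 2"
    "\<And>n. w n = None \<Longrightarrow> snd (r (Suc n)) = snd (r n)"
    "\<And>n. w n \<noteq> None \<Longrightarrow> the (w n) \<in> binary_digits \<and>
       snd (r (Suc n)) = 2 * snd (r n) + the (v n) - the (w n)"
    by metis
  have init: "r 0 = (td_initial T, 0)"
    using run by (simp add: transducer_run_def binary_output_def)
  then have "transducer_run T \<alpha> (\<lambda>n. fst (r n)) v"
    using v(1) by (simp add: transducer_run_def)
  from computes_output[OF c x \<alpha>' this] obtain \<gamma>
    where \<gamma>: "writes D v \<gamma>" "represents signed_digits \<gamma> (f x)" .
  define \<beta> where "\<beta> n = the (w (D + n))" for n
  have wD: "w n = None \<longleftrightarrow> n < D" for n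
    using v(2)[of n] writesD[OF \<gamma>(1), of n] by (simp split: if_splits)
  then have w: "writes D w \<beta>"
    by (auto simp: writes_def \<beta>_def)
  have \<beta>: "range \<beta> \<subseteq> binary_digits"
    using v(5) wD by (auto simp: \<beta>_def)
  have d0: "n \<le> D \<Longrightarrow> snd (r n) = 0" for n
    by (induction n) (use init v(4) wD in auto)
  have "snd (r (D + n)) = prefix_value \<gamma> n - prefix_value \<beta> n" for n
  proof (induction n)
    case (Suc n)
    then show ?case
      using v(5)[of "D + n"] wD[of "D + n"] writesD[OF \<gamma>(1), of "D + n"] by (simp add: \<beta>_def)
  qed (simp add: d0)
  \<comment> \<open>The bound is known for targets of transitions only, so index 0 is settled by the
    initial state.\<close>
  moreover have "\<bar>snd (r n)\<bar> \<le> 2" for n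
    using v(3)[of "n - 1"] init by (cases n) auto
  ultimately have "word_value \<gamma> = word_value \<beta>"
    using \<gamma> \<beta> binary_subset_signed
    by (intro word_value_eq_if_prefix_diff_bounded[where C = 2]) (auto simp: represents_def, metis)
  with w \<beta> \<gamma> show "\<exists>\<beta>. writes D w \<beta> \<and> represents binary_digits \<beta> (f x)"
    by (auto simp: represents_def)
qed

lemma det_signed_imp_nondet_binary:
  assumes "det_computable signed_digits f" "f ` {0..1} \<subseteq> {0..1}"
  shows "nondet_computable binary_digits f"
  using assms unfolding det_computable_def
  by (blast intro: nondet_computableI binary_output_with_delay binary_output_computes)

section \<open>Functions computed by binary transducers\<close>

text \<open>For fixed \<open>n\<close> the scaled differences converge; if their limit exceeded
  \<open>C\<close>, almost all of them would, so a bound holding infinitely often passes to the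
  limit.\<close>

lemma frequently_sequentially_near_limit:
  fixes X :: "nat \<Rightarrow> real"
  assumes "X \<longlonglongrightarrow> x" "\<And>n. \<exists>\<^sub>\<infinity>k. \<bar>2 ^ n * X k - 2 ^ n * y\<bar> \<le> C"
  shows "x = y"
proof (rule eq_if_power_two_diff_bounded[where N = 0 and C = C])
  fix n :: nat
  let ?Y = "\<lambda>k. \<bar>2 ^ n * X k - 2 ^ n * y\<bar>"
  have "?Y \<longlonglongrightarrow> \<bar>2 ^ n * x - 2 ^ n * y\<bar>"
    by (intro tendsto_intros assms(1))
  from order_tendstoD(1)[OF this, of C] show "\<bar>2 ^ n * x - 2 ^ n * y\<bar> \<le> C"
    using assms(2)[of n] unfolding cofinite_eq_sequentially frequently_def not_le by linarith
qed

text \<open>Runs on representations of the points \<open>X k\<close> have a pointwise limit, which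
  is a run on a representation of \<open>x\<close> and writes a representation of \<open>y\<close>.
  As every infinite run on a representation of \<open>x\<close> writes a representation of
  \<open>f x\<close>, the two values agree.\<close>

lemma nondet_binary_limit:
  assumes T: "transducer_with_delay binary_digits D T" and c: "computes binary_digits D T f"
    and X: "\<And>k. X k \<in> {0..1}" "X \<longlonglongrightarrow> x" and fX: "(\<lambda>k. f (X k)) \<longlonglongrightarrow> y"
  shows "f x = y"
proof -
  have "\<forall>k. \<exists>\<alpha> q w \<beta>. represents binary_digits \<alpha> (X k) \<and> transducer_run T \<alpha> q w \<and>
      writes D w \<beta> \<and> represents binary_digits \<beta> (f (X k))"
    using ex_binary_representation[OF X(1)] computes_ex_run[OF c X(1)] computes_output[OF c X(1)]
    by (metis (no_types))
  then obtain \<alpha> q w \<beta> where \<alpha>: "\<And>k. represents binary_digits (\<alpha> k) (X k)"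
    and run: "\<And>k. transducer_run T (\<alpha> k) (q k) (w k)"
    and w: "\<And>k. writes D (w k) (\<beta> k)" and \<beta>: "\<And>k. represents binary_digits (\<beta> k) (f (X k))"
    by metis
  \<comment> \<open>States, inputs, written symbols and outputs are packed into one letter, so that
    a single limit serves all four.\<close>
  let ?A = "td_states T \<times> binary_digits \<times> insert None (Some ` binary_digits) \<times> binary_digits"
  have "finite ?A"
    using T by (simp add: transducer_with_delay_def binary_digits_def)
  moreover have "(q k i, \<alpha> k i, w k i, \<beta> k i) \<in> ?A" for k i
  proof -
    have "\<beta> k i \<in> binary_digits"
      using \<beta>[of k] by (auto simp: represents_def)
    moreover have "(q k i, \<alpha> k i, w k i, q k (Suc i)) \<in> td_trans T"
      using run[of k] by (simp add: transducer_run_def)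
    ultimately show ?thesis
      using T by (auto simp: transducer_with_delay_def)
  qed
  ultimately obtain l where l: "\<And>n. \<exists>\<^sub>\<infinity>k. \<forall>i<n. (q k i, \<alpha> k i, w k i, \<beta> k i) = l i"
    using pointwise_limit_of_words[of ?A "\<lambda>k i. (q k i, \<alpha> k i, w k i, \<beta> k i)"] by blast
  define q' where "q' i = fst (l i)" for i
  define \<alpha>' where "\<alpha>' i = fst (snd (l i))" for i
  define w' where "w' i = fst (snd (snd (l i)))" for i
  define \<beta>' where "\<beta>' i = snd (snd (snd (l i)))" for i
  have lim: "\<exists>\<^sub>\<infinity>k. \<forall>i<n. q k i = q' i \<and> \<alpha> k i = \<alpha>' i \<and> w k i = w' i \<and> \<beta> k i = \<beta>' i" for n
    using l[of n] by (rule INFM_mono) (auto simp: q'_def \<alpha>'_def w'_def \<beta>'_def prod_eq_iff)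
  have ex: "\<exists>k. \<forall>i<n. q k i = q' i \<and> \<alpha> k i = \<alpha>' i \<and> w k i = w' i \<and> \<beta> k i = \<beta>' i" for n
    using lim[of n] by (rule INFM_EX)
  have \<alpha>'b: "range \<alpha>' \<subseteq> binary_digits"
    using ex \<alpha> unfolding represents_def by (metis lessI image_subset_iff)
  have \<beta>'b: "range \<beta>' \<subseteq> binary_digits"
    using ex \<beta> unfolding represents_def by (metis lessI image_subset_iff)
  have "q' 0 = td_initial T"
    using ex[of 1] run by (auto simp: transducer_run_def)
  moreover have "(q' n, \<alpha>' n, w' n, q' (Suc n)) \<in> td_trans T" for n
  proof -
    \<comment> \<open>Agreement up to index \<open>n + 1\<close> is needed to cover both end states
      of the transition.\<close>
    from ex[of "Suc (Suc n)"] obtain k where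
      "\<forall>i<Suc (Suc n). q k i = q' i \<and> \<alpha> k i = \<alpha>' i \<and> w k i = w' i \<and> \<beta> k i = \<beta>' i" ..
    moreover have "(q k n, \<alpha> k n, w k n, q k (Suc n)) \<in> td_trans T"
      using run[of k] by (simp add: transducer_run_def)
    ultimately show ?thesis
      by simp
  qed
  ultimately have run': "transducer_run T \<alpha>' q' w'"
    by (simp add: transducer_run_def)
  have w'\<beta>': "w' (D + n) = Some (\<beta>' n)" for n
  proof -
    from ex[of "Suc (D + n)"] obtain k where
      k: "\<forall>i<Suc (D + n). q k i = q' i \<and> \<alpha> k i = \<alpha>' i \<and> w k i = w' i \<and> \<beta> k i = \<beta>' i" ..
    have "w k (D + n) = w' (D + n)" "\<beta> k n = \<beta>' n"
      by (simp_all add: k)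
    with w[of k] show ?thesis
      unfolding writes_def by metis
  qed
  have "x = word_value \<alpha>'"
  proof (rule frequently_sequentially_near_limit[OF X(2)])
    fix n
    show "\<exists>\<^sub>\<infinity>k. \<bar>2 ^ n * X k - 2 ^ n * word_value \<alpha>'\<bar> \<le> 2"
      using lim[of n]
    proof (rule INFM_mono)
      fix k
      assume "\<forall>i<n. q k i = q' i \<and> \<alpha> k i = \<alpha>' i \<and> w k i = w' i \<and> \<beta> k i = \<beta>' i"
      then show "\<bar>2 ^ n * X k - 2 ^ n * word_value \<alpha>'\<bar> \<le> 2"
        using word_value_diff_le_if_prefix_eq[of "\<alpha> k" \<alpha>' n] \<alpha>[of k] \<alpha>'b binary_subset_signed
        by (auto simp: represents_def)
    qed
  qed
  have "y = word_value \<beta>'"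
  proof (rule frequently_sequentially_near_limit[OF fX])
    fix n
    show "\<exists>\<^sub>\<infinity>k. \<bar>2 ^ n * f (X k) - 2 ^ n * word_value \<beta>'\<bar> \<le> 2"
      using lim[of n]
    proof (rule INFM_mono)
      fix k
      assume "\<forall>i<n. q k i = q' i \<and> \<alpha> k i = \<alpha>' i \<and> w k i = w' i \<and> \<beta> k i = \<beta>' i"
      then show "\<bar>2 ^ n * f (X k) - 2 ^ n * word_value \<beta>'\<bar> \<le> 2"
        using word_value_diff_le_if_prefix_eq[of "\<beta> k" \<beta>' n] \<beta>[of k] \<beta>'b binary_subset_signed
        by (auto simp: represents_def)
    qed
  qed
  have "x \<in> {0..1}" "represents binary_digits \<alpha>' x"
    using word_value_binary[OF \<alpha>'b] \<open>x = word_value \<alpha>'\<close> \<alpha>'b by (auto simp: represents_def)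
  from computes_output[OF c this run'] obtain \<gamma>
    where \<gamma>: "writes D w' \<gamma>" "represents binary_digits \<gamma> (f x)" .
  have "\<gamma> = \<beta>'"
    using \<gamma>(1) w'\<beta>' by (auto simp: writes_def)
  with \<gamma>(2) \<open>y = word_value \<beta>'\<close> show ?thesis
    by (simp add: represents_def)
qed

text \<open>A map into a compact space is continuous if its graph is closed, and
  \<open>nondet_binary_limit\<close> supplies the closedness by sequences.\<close>

lemma nondet_binary_continuous:
  assumes T: "transducer_with_delay binary_digits D T" and c: "computes binary_digits D T f"
    and f: "f ` {0..1} \<subseteq> {0..1}"
  shows "continuous_on {0..1} f"
proof -
  have "closed ((\<lambda>x. (x, f x)) ` {0..1})"
    unfolding closed_sequential_limits
  proof (intro allI impI, elim conjE)
    fix P :: "nat \<Rightarrow> real \<times> real" and p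
    assume P: "\<forall>k. P k \<in> (\<lambda>x. (x, f x)) ` {0..1}" and lim: "P \<longlonglongrightarrow> p"
    have X: "fst (P k) \<in> {0..1}" "snd (P k) = f (fst (P k))" for k
      using P by (auto dest!: spec[of _ k])
    have "(\<lambda>k. fst (P k)) \<longlonglongrightarrow> fst p"
      using lim by (rule tendsto_fst)
    moreover have "(\<lambda>k. f (fst (P k))) \<longlonglongrightarrow> snd p"
      using tendsto_snd[OF lim] X(2) by simp
    ultimately have "f (fst p) = snd p"
      by (rule nondet_binary_limit[OF T c X(1)])
    moreover have "fst p \<in> {0..1}"
      using closed_sequentially[OF closed_atLeastAtMost _ \<open>(\<lambda>k. fst (P k)) \<longlonglongrightarrow> fst p\<close>] X(1) by blast
    ultimately show "p \<in> (\<lambda>x. (x, f x)) ` {0..1}"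
      by (cases p) auto
  qed
  moreover have "(\<lambda>x. (x, f x)) ` {0..1} \<subseteq> {0..1} \<times> {0..1}"
    using f by auto
  ultimately have "closedin (top_of_set ({0..1} \<times> {0..1})) ((\<lambda>x. (x, f x)) ` {0..1})"
    by (intro closed_subset)
  then show ?thesis
    using f by (subst continuous_closed_graph_eq[of "{0..1}"]) auto
qed

text \<open>
  The automaton guesses a run of \<open>T\<close> on \<open>\<alpha>\<close>. Its register holds \<open>2 ^ D\<close> times the prefix
  value of the output of \<open>T\<close> minus the prefix value of \<open>\<beta>\<close>; the factor compensates for the
  output lagging \<open>D\<close> digits behind, so that no digits of \<open>\<beta>\<close> have to be buffered. The flag tells
  which of the two interleaved words the next digit belongs to.
\<close>

definition graph_automaton ::
  "nat \<Rightarrow> ('q, int) transducer \<Rightarrow> ('q \<times> int \<times> bool, int) buchi" where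
  "graph_automaton D T =
    (let S = td_states T \<times> {-(4 * 2 ^ D)..4 * 2 ^ D} \<times> UNIV in
     \<lparr>buchi_states = S, buchi_initial = {(td_initial T, 0, False)},
      buchi_trans = (S \<times> binary_digits \<times> S) \<inter>
       ({((q, e, False), a, (q', 2 * e + 2 ^ D * (case w of None \<Rightarrow> 0 | Some c \<Rightarrow> c), True)) |
          q e a w q'. (q, a, w, q') \<in> td_trans T} \<union>
        {((q, e, True), b, (q, e - b, False)) | q e b. True}),
      buchi_accepting = S\<rparr>)"

lemma graph_automaton_is_automaton:
  "transducer_with_delay binary_digits D T \<Longrightarrow> buchi_automaton binary_digits (graph_automaton D T)"
  by (auto simp: graph_automaton_def buchi_automaton_def transducer_with_delay_def Let_def)

lemma interleave_even [simp]: "interleave \<alpha> \<beta> (2 * n) = \<alpha> n"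
  and interleave_odd [simp]: "interleave \<alpha> \<beta> (Suc (2 * n)) = \<beta> n"
  by (simp_all add: interleave_def)

text \<open>All states are accepting, so acceptance only says that the register never leaves its
  range; this bound already forces the two values to be equal.\<close>

lemma graph_automaton_sound:
  assumes c: "computes binary_digits D T f"
    and \<alpha>: "range \<alpha> \<subseteq> binary_digits" and \<beta>: "range \<beta> \<subseteq> binary_digits"
    and acc: "buchi_accepts (graph_automaton D T) (interleave \<alpha> \<beta>)"
  shows "f (word_value \<alpha>) = word_value \<beta>"
proof -
  obtain r where init: "r 0 = (td_initial T, 0, False)"
    and r: "\<And>n. (r n, interleave \<alpha> \<beta> n, r (Suc n)) \<in> buchi_trans (graph_automaton D T)"
    using acc by (auto simp: buchi_accepts_def graph_automaton_def Let_def)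
  \<comment> \<open>The flag records parity, so digits of \<alpha> are read by moves of
    \<open>T\<close> and digits of \<beta> by subtractions.\<close>
  have flag: "snd (snd (r n)) \<longleftrightarrow> odd n" for n
  proof (induction n)
    case (Suc n)
    with r[of n] show ?case
      by (auto simp: graph_automaton_def Let_def)
  qed (simp add: init)
  define q where "q n = fst (r (2 * n))" for n
  define e where "e n = fst (snd (r (2 * n)))" for n
  have "\<exists>w. (q n, \<alpha> n, w, q (Suc n)) \<in> td_trans T \<and>
      e (Suc n) = 2 * e n + 2 ^ D * (case w of None \<Rightarrow> 0 | Some c \<Rightarrow> c) - \<beta> n" for n
    using r[of "2 * n"] r[of "Suc (2 * n)"] flag[of "2 * n"] flag[of "Suc (2 * n)"]
    by (auto simp: graph_automaton_def Let_def q_def e_def)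
  then obtain w where w: "\<And>n. (q n, \<alpha> n, w n, q (Suc n)) \<in> td_trans T"
    and e: "\<And>n. e (Suc n) = 2 * e n + 2 ^ D * (case w n of None \<Rightarrow> 0 | Some c \<Rightarrow> c) - \<beta> n"
    by metis
  have "transducer_run T \<alpha> q w"
    using init w by (simp add: transducer_run_def q_def)
  moreover have "represents binary_digits \<alpha> (word_value \<alpha>)"
    using \<alpha> by (simp add: represents_def)
  ultimately obtain \<gamma> where \<gamma>: "writes D w \<gamma>" "represents binary_digits \<gamma> (f (word_value \<alpha>))"
    using computes_output[OF c word_value_binary[OF \<alpha>]] by blast
  \<comment> \<open>During the delay \<open>T\<close> contributes nothing; the case
    \<open>n = D\<close> starts the induction for \<open>e_eq\<close>.\<close>
  have "n \<le> D \<Longrightarrow> e n = - prefix_value \<beta> n" for n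
    by (induction n) (auto simp: e writesD[OF \<gamma>(1)], simp add: e_def init)
  then have e_eq: "e (D + n) = 2 ^ D * prefix_value \<gamma> n - prefix_value \<beta> (D + n)" for n
    by (induction n) (simp_all add: e writesD[OF \<gamma>(1)] algebra_simps)
  have e_le: "\<bar>e n\<bar> \<le> 4 * 2 ^ D" for n
    using r[of "2 * n"] by (auto simp: graph_automaton_def Let_def e_def abs_le_iff)
  have "word_value \<gamma> = word_value \<beta>"
  \<comment> \<open>The register contributes \<open>4 * 2 ^ D\<close>, the scaled tail of \<gamma>
    contributes \<open>2 ^ D\<close> and the tail of \<beta> contributes 1. Since
    \<open>e_eq\<close> speaks of indices from \<open>D\<close> on, \<open>N = D\<close>.\<close>
  proof (rule eq_if_power_two_diff_bounded[where N = D and C = "5 * 2 ^ D + 1"])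
    fix n
    assume "D \<le> n"
    then obtain m where n: "n = D + m"
      by (metis le_add_diff_inverse)
    have \<gamma>': "range \<gamma> \<subseteq> signed_digits" and \<beta>': "range \<beta> \<subseteq> signed_digits"
      using \<gamma>(2) \<beta> binary_subset_signed by (auto simp: represents_def)
    have "\<bar>2 ^ n * word_value \<gamma> - 2 ^ D * prefix_value \<gamma> m\<bar> \<le> 2 ^ D"
      using prefix_value_approx_scaled[OF \<gamma>'] by (simp add: n)
    moreover have "\<bar>real_of_int (2 ^ D * prefix_value \<gamma> m - prefix_value \<beta> n)\<bar> \<le> 4 * 2 ^ D"
    proof -
      have "real_of_int \<bar>e n\<bar> \<le> real_of_int (4 * 2 ^ D)"
        using e_le by (simp only: of_int_le_iff)
      then show ?thesis
        by (simp add: n e_eq)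
    qed
    ultimately show "\<bar>2 ^ n * word_value \<gamma> - 2 ^ n * word_value \<beta>\<bar> \<le> 5 * 2 ^ D + 1"
      using prefix_value_approx[OF \<beta>', of n] by simp
  qed
  with \<gamma>(2) show ?thesis
    by (simp add: represents_def)
qed

text \<open>Any run of \<open>T\<close> on \<alpha> will do, whichever representation \<beta> of the
  value is given: its output has the same value as \<beta>, which keeps the register in
  range.\<close>

lemma graph_automaton_complete:
  assumes T: "transducer_with_delay binary_digits D T" and c: "computes binary_digits D T f"
    and \<alpha>: "range \<alpha> \<subseteq> binary_digits" and \<beta>: "range \<beta> \<subseteq> binary_digits"
    and eq: "f (word_value \<alpha>) = word_value \<beta>"
  shows "buchi_accepts (graph_automaton D T) (interleave \<alpha> \<beta>)"
proof -
  have \<alpha>': "represents binary_digits \<alpha> (word_value \<alpha>)"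
    using \<alpha> by (simp add: represents_def)
  obtain q w where run: "transducer_run T \<alpha> q w"
    using computes_ex_run[OF c word_value_binary[OF \<alpha>] \<alpha>'] .
  obtain \<gamma> where w: "writes D w \<gamma>" and \<gamma>: "represents binary_digits \<gamma> (f (word_value \<alpha>))"
    using computes_output[OF c word_value_binary[OF \<alpha>] \<alpha>' run] .
  have \<gamma>': "range \<gamma> \<subseteq> signed_digits" and \<beta>': "range \<beta> \<subseteq> signed_digits"
    using \<gamma> \<beta> binary_subset_signed by (auto simp: represents_def)
  have val: "word_value \<gamma> = word_value \<beta>"
    using \<gamma> eq by (simp add: represents_def)
  define e where "e n = 2 ^ D * prefix_value \<gamma> (n - D) - prefix_value \<beta> n" for n
  define c where "c n = (case w n of None \<Rightarrow> 0 | Some c \<Rightarrow> c)" for n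
  have e_Suc: "e (Suc n) = 2 * e n + 2 ^ D * c n - \<beta> n" for n
    by (auto simp: e_def c_def writesD[OF w] Suc_diff_le algebra_simps)
  have "\<bar>real_of_int (e n)\<bar> \<le> 2 ^ D + 1" for n
  proof -
    have "\<bar>2 ^ D * prefix_value \<gamma> (n - D) - 2 ^ n * word_value \<beta>\<bar> \<le> 2 ^ D"
    \<comment> \<open>During the delay the prefix of \<gamma> is empty, and
      \<open>2 ^ n * word_value \<beta>\<close> alone is at most \<open>2 ^ D\<close>.\<close>
    proof (cases "n < D")
      case True
      have "2 ^ n * word_value \<beta> \<le> 2 ^ D * 1"
        using word_value_binary[OF \<beta>] True by (intro mult_mono power_increasing) auto
      with True word_value_binary[OF \<beta>] show ?thesis
        by simp
    next
      case False
      then obtain m where n: "n = D + m"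
        by (metis add_diff_inverse_nat)
      then show ?thesis
        using prefix_value_approx_scaled[OF \<gamma>', of D m] by (simp add: val abs_minus_commute)
    qed
    then show ?thesis
      using prefix_value_approx[OF \<beta>', of n] by (simp add: e_def)
  qed
  then have "real_of_int \<bar>e n\<bar> \<le> real_of_int (2 ^ D + 1)" for n
    by simp
  then have e_le: "\<bar>e n\<bar> \<le> 2 ^ D + 1" for n
    by (simp only: of_int_le_iff)
  have D1: "(2 :: int) ^ D \<ge> 1"
    by simp
  have e_range: "e n \<in> {-(4 * 2 ^ D)..4 * 2 ^ D}" for n
    using e_le[of n] D1 unfolding atLeastAtMost_iff by linarith
  \<comment> \<open>Between the two half steps the register is \<open>e (Suc n) + \<beta> n\<close>,
    of absolute value at most \<open>2 ^ D + 2\<close>, still within the allowed range.\<close>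
  have half_range: "2 * e n + 2 ^ D * c n \<in> {-(4 * 2 ^ D)..4 * 2 ^ D}" for n
    using e_le[of "Suc n"] signed_digit_abs_le[OF \<beta>', of n] D1 e_Suc[of n]
    unfolding atLeastAtMost_iff by linarith
  have qT: "(q n, \<alpha> n, w n, q (Suc n)) \<in> td_trans T" for n
    using run by (simp add: transducer_run_def)
  then have qS: "q n \<in> td_states T" for n
    using T by (fastforce simp: transducer_with_delay_def)
  define r where "r m = (let n = m div 2 in
    if even m then (q n, e n, False) else (q (Suc n), 2 * e n + 2 ^ D * c n, True))" for m
  have r: "r (2 * n) = (q n, e n, False)"
    "r (Suc (2 * n)) = (q (Suc n), 2 * e n + 2 ^ D * c n, True)" for n
    by (simp_all add: r_def)
  have "(r m, interleave \<alpha> \<beta> m, r (Suc m)) \<in> buchi_trans (graph_automaton D T)" for m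
  proof (cases "even m")
    case True
    then obtain n where m: "m = 2 * n" ..
    have "\<alpha> n \<in> binary_digits"
      using \<alpha> by auto
    with qT[of n] qS e_range[of n] half_range[of n] show ?thesis
      unfolding m r interleave_even graph_automaton_def Let_def c_def by auto
  next
    case False
    then obtain n where m: "m = Suc (2 * n)"
      by (metis oddE Suc_eq_plus1)
    have "r (Suc m) = (q (Suc n), e (Suc n), False)"
      using r(1)[of "Suc n"] m by simp
    moreover have "\<beta> n \<in> binary_digits"
      using \<beta> by auto
    ultimately show ?thesis
      using qS half_range[of n] e_range[of "Suc n"] e_Suc[of n]
      unfolding m r interleave_odd graph_automaton_def Let_def by simp
  qed
  moreover have "r 0 \<in> buchi_initial (graph_automaton D T)"
    using run by (simp add: r_def e_def graph_automaton_def Let_def transducer_run_def)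
  moreover have "r m \<in> buchi_accepting (graph_automaton D T)" for m
    using qS e_range half_range by (simp add: r_def graph_automaton_def Let_def)
  ultimately show ?thesis
    unfolding buchi_accepts_def by (intro exI[of _ r]) simp
qed

lemma nondet_binary_imp_continuous_regular:
  assumes "nondet_computable binary_digits f" "f ` {0..1} \<subseteq> {0..1}"
  shows "continuous_on {0..1} f \<and> regular_function f"
proof -
  obtain D and T :: "(nat, int) transducer"
    where T: "transducer_with_delay binary_digits D T" and c: "computes binary_digits D T f"
    using assms(1) by (auto simp: nondet_computable_def)
  have "regular_function f"
    by (rule regular_functionI[OF graph_automaton_is_automaton[OF T]])
       (use graph_automaton_sound[OF c] graph_automaton_complete[OF T c] in blast)
  with nondet_binary_continuous[OF T c assms(2)] show ?thesis
    by simp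
qed

section \<open>Local behaviour of continuous regular functions\<close>

primrec buchi_post :: "('q, 'a) buchi \<Rightarrow> (nat \<Rightarrow> 'a) \<Rightarrow> nat \<Rightarrow> 'q set" where
  "buchi_post A w 0 = buchi_initial A"
| "buchi_post A w (Suc n) = {q'. \<exists>q \<in> buchi_post A w n. (q, w n, q') \<in> buchi_trans A}"

definition buchi_accepts_from :: "('q, 'a) buchi \<Rightarrow> 'q set \<Rightarrow> (nat \<Rightarrow> 'a) \<Rightarrow> bool" where
  "buchi_accepts_from A S w \<longleftrightarrow>
     (\<exists>q. q 0 \<in> S \<and> (\<forall>n. (q n, w n, q (Suc n)) \<in> buchi_trans A) \<and>
          (\<exists>\<^sub>\<infinity>n. q n \<in> buchi_accepting A))"

lemma buchi_post_cong:
  "(\<And>i. i < n \<Longrightarrow> w i = w' i) \<Longrightarrow> buchi_post A w n = buchi_post A w' n"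
  by (induction n) auto

lemma buchi_post_subset: "buchi_automaton \<Sigma> A \<Longrightarrow> buchi_post A w n \<subseteq> buchi_states A"
  by (cases n) (auto simp: buchi_automaton_def)

lemma INFM_Suc_iff: "(\<exists>\<^sub>\<infinity>n. P (Suc n)) \<longleftrightarrow> (\<exists>\<^sub>\<infinity>n. P n)"
  unfolding cofinite_eq_sequentially frequently_def
  using eventually_sequentially_Suc[of "\<lambda>n. \<not> P n"] by simp

lemma buchi_accepts_from_step:
  "buchi_accepts_from A S w \<longleftrightarrow>
   buchi_accepts_from A {q'. \<exists>q\<in>S. (q, w 0, q') \<in> buchi_trans A} (\<lambda>i. w (Suc i))"
proof
  assume "buchi_accepts_from A S w"
  then obtain q where q: "q 0 \<in> S" "\<forall>n. (q n, w n, q (Suc n)) \<in> buchi_trans A"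
    "\<exists>\<^sub>\<infinity>n. q n \<in> buchi_accepting A"
    by (auto simp: buchi_accepts_from_def)
  have "\<exists>\<^sub>\<infinity>n. q (Suc n) \<in> buchi_accepting A"
    using q(3) by (simp add: INFM_Suc_iff[of "\<lambda>n. q n \<in> buchi_accepting A"])
  then show "buchi_accepts_from A {q'. \<exists>q\<in>S. (q, w 0, q') \<in> buchi_trans A} (\<lambda>i. w (Suc i))"
    unfolding buchi_accepts_from_def using q by (intro exI[of _ "\<lambda>i. q (Suc i)"]) auto
next
  assume "buchi_accepts_from A {q'. \<exists>q\<in>S. (q, w 0, q') \<in> buchi_trans A} (\<lambda>i. w (Suc i))"
  then obtain q q0 where q: "q0 \<in> S" "(q0, w 0, q 0) \<in> buchi_trans A"
    "\<forall>n. (q n, w (Suc n), q (Suc n)) \<in> buchi_trans A" "\<exists>\<^sub>\<infinity>n. q n \<in> buchi_accepting A"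
    by (auto simp: buchi_accepts_from_def)
  let ?q = "case_nat q0 q"
  have "\<exists>\<^sub>\<infinity>n. ?q n \<in> buchi_accepting A"
    using q(4) INFM_Suc_iff[of "\<lambda>n. ?q n \<in> buchi_accepting A"] by simp
  then show "buchi_accepts_from A S w"
    unfolding buchi_accepts_from_def using q
    by (intro exI[of _ ?q]) (auto split: nat.split)
qed

text \<open>A prefix influences acceptance only through the set of states it reaches. This is the
  source of all finiteness statements below.\<close>

lemma buchi_accepts_iff_from_post:
  "buchi_accepts A w \<longleftrightarrow> buchi_accepts_from A (buchi_post A w n) (\<lambda>i. w (i + n))"
proof (induction n)
  case (Suc n)
  then show ?case
    by (subst (asm) buchi_accepts_from_step) simp
qed (simp add: buchi_accepts_def buchi_accepts_from_def)

section \<open>Pieces of the graph in dyadic squares\<close>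

definition append_word :: "nat \<Rightarrow> (nat \<Rightarrow> 'a) \<Rightarrow> (nat \<Rightarrow> 'a) \<Rightarrow> nat \<Rightarrow> 'a" where
  "append_word n u \<alpha> i = (if i < n then u i else \<alpha> (i - n))"

lemma append_word_range: "range u \<subseteq> A \<Longrightarrow> range \<alpha> \<subseteq> A \<Longrightarrow> range (append_word n u \<alpha>) \<subseteq> A"
  by (auto simp: append_word_def)

lemma word_value_append:
  assumes "range u \<subseteq> binary_digits" "range \<alpha> \<subseteq> binary_digits"
  shows "word_value (append_word n u \<alpha>) = (prefix_value u n + word_value \<alpha>) / 2 ^ n"
proof -
  have "range (append_word n u \<alpha>) \<subseteq> signed_digits"
    using append_word_range[OF assms, of n] binary_subset_signed by blast
  moreover have "(\<lambda>i. append_word n u \<alpha> (i + n)) = \<alpha>"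
    by (auto simp: append_word_def)
  moreover have "prefix_value (append_word n u \<alpha>) n = prefix_value u n"
    by (rule prefix_value_cong) (simp add: append_word_def)
  ultimately show ?thesis
    using word_value_split[of "append_word n u \<alpha>" n] by (simp add: field_simps)
qed

text \<open>Square \<open>(k, j)\<close> of the grid of mesh \<open>1 / 2 ^ n\<close> is blown up to
  the unit square. Indices outside the grid give the empty set, so neighbouring squares can be
  addressed without side conditions.\<close>

definition unit_graph :: "(real \<Rightarrow> real) \<Rightarrow> nat \<Rightarrow> int \<Rightarrow> int \<Rightarrow> (real \<times> real) set" where
  "unit_graph f n k j =
     (if 0 \<le> k \<and> k < 2 ^ n \<and> 0 \<le> j \<and> j < 2 ^ n
      then {(s, y). s \<in> {0..1} \<and> y \<in> {0..1} \<and> f ((k + s) / 2 ^ n) = (j + y) / 2 ^ n} else {})"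

text \<open>The prefixes \<open>u\<close> and \<open>v\<close> select the square, and the tails are
  binary expansions of the coordinates inside it. Points with several expansions cause no conflict,
  as \<open>acc\<close> holds for each of them.\<close>

lemma unit_graph_eq_residual:
  assumes acc: "\<And>\<alpha> \<beta>. range \<alpha> \<subseteq> binary_digits \<Longrightarrow> range \<beta> \<subseteq> binary_digits \<Longrightarrow>
      buchi_accepts A (interleave \<alpha> \<beta>) \<longleftrightarrow> f (word_value \<alpha>) = word_value \<beta>"
    and u: "range u \<subseteq> binary_digits" "prefix_value u n = k"
    and v: "range v \<subseteq> binary_digits" "prefix_value v n = j"
    and k: "0 \<le> k" "k < 2 ^ n" and j: "0 \<le> j" "j < 2 ^ n"
  shows "unit_graph f n k j =
    {(word_value \<alpha>, word_value \<beta>) | \<alpha> \<beta>. range \<alpha> \<subseteq> binary_digits \<and> range \<beta> \<subseteq> binary_digits \<and>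
       buchi_accepts_from A (buchi_post A (interleave u v) (2 * n)) (interleave \<alpha> \<beta>)}"
proof -
  have iff: "f ((k + word_value \<alpha>) / 2 ^ n) = (j + word_value \<beta>) / 2 ^ n \<longleftrightarrow>
      buchi_accepts_from A (buchi_post A (interleave u v) (2 * n)) (interleave \<alpha> \<beta>)"
    if \<alpha>: "range \<alpha> \<subseteq> binary_digits" and \<beta>: "range \<beta> \<subseteq> binary_digits" for \<alpha> \<beta>
  proof -
    let ?w = "interleave (append_word n u \<alpha>) (append_word n v \<beta>)"
    \<comment> \<open>The first \<open>n\<close> digits of both words fill the first
      \<open>2 * n\<close> places of the interleaving.\<close>
    have "buchi_post A ?w (2 * n) = buchi_post A (interleave u v) (2 * n)"
      by (rule buchi_post_cong) (auto simp: interleave_def append_word_def)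
    moreover have "(\<lambda>i. ?w (i + 2 * n)) = interleave \<alpha> \<beta>"
      by (auto simp: interleave_def append_word_def fun_eq_iff)
    ultimately show ?thesis
      using acc[OF append_word_range[OF u(1) \<alpha>, of n] append_word_range[OF v(1) \<beta>, of n]]
        buchi_accepts_iff_from_post[of A ?w "2 * n"]
      by (simp add: word_value_append u v \<alpha> \<beta>)
  qed
  have mem: "(s, y) \<in> unit_graph f n k j \<longleftrightarrow> (\<exists>\<alpha> \<beta>. (s, y) = (word_value \<alpha>, word_value \<beta>) \<and>
      range \<alpha> \<subseteq> binary_digits \<and> range \<beta> \<subseteq> binary_digits \<and>
      f ((k + word_value \<alpha>) / 2 ^ n) = (j + word_value \<beta>) / 2 ^ n)" for s y
  proof
    assume *: "(s, y) \<in> unit_graph f n k j"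
    then have "s \<in> {0..1}" "y \<in> {0..1}"
      by (auto simp: unit_graph_def split: if_splits)
    then obtain \<alpha> \<beta> where "represents binary_digits \<alpha> s" "represents binary_digits \<beta> y"
      using ex_binary_representation by metis
    with * show "\<exists>\<alpha> \<beta>. (s, y) = (word_value \<alpha>, word_value \<beta>) \<and>
        range \<alpha> \<subseteq> binary_digits \<and> range \<beta> \<subseteq> binary_digits \<and>
        f ((k + word_value \<alpha>) / 2 ^ n) = (j + word_value \<beta>) / 2 ^ n"
      by (intro exI[of _ \<alpha>] exI[of _ \<beta>]) (auto simp: represents_def unit_graph_def split: if_splits)
  next
    assume "\<exists>\<alpha> \<beta>. (s, y) = (word_value \<alpha>, word_value \<beta>) \<and>
        range \<alpha> \<subseteq> binary_digits \<and> range \<beta> \<subseteq> binary_digits \<and>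
        f ((k + word_value \<alpha>) / 2 ^ n) = (j + word_value \<beta>) / 2 ^ n"
    then show "(s, y) \<in> unit_graph f n k j"
      using k j word_value_binary unfolding unit_graph_def by fastforce
  qed
  show ?thesis
  proof (intro set_eqI)
    fix p
    show "p \<in> unit_graph f n k j \<longleftrightarrow> p \<in> {(word_value \<alpha>, word_value \<beta>) | \<alpha> \<beta>.
        range \<alpha> \<subseteq> binary_digits \<and> range \<beta> \<subseteq> binary_digits \<and>
        buchi_accepts_from A (buchi_post A (interleave u v) (2 * n)) (interleave \<alpha> \<beta>)}"
      using iff by (cases p) (auto simp only: mem mem_Collect_eq; blast)
  qed
qed

text \<open>A piece depends on its square only through the set of states reached, and there are
  finitely many such sets. The empty set is added for squares outside the grid.\<close>

lemma finite_unit_graphs: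
  assumes "regular_function f"
  shows "finite {unit_graph f n k j | n k j. True}"
proof -
  obtain A :: "(nat, int) buchi" where A: "buchi_automaton binary_digits A"
    and acc: "\<And>\<alpha> \<beta>. range \<alpha> \<subseteq> binary_digits \<Longrightarrow> range \<beta> \<subseteq> binary_digits \<Longrightarrow>
      buchi_accepts A (interleave \<alpha> \<beta>) \<longleftrightarrow> f (word_value \<alpha>) = word_value \<beta>"
    using assms unfolding regular_function_def by blast
  let ?R = "\<lambda>S. {(word_value \<alpha>, word_value \<beta>) | \<alpha> \<beta>. range \<alpha> \<subseteq> binary_digits \<and>
      range \<beta> \<subseteq> binary_digits \<and> buchi_accepts_from A S (interleave \<alpha> \<beta>)}"
  have "{unit_graph f n k j | n k j. True} \<subseteq> insert {} (?R ` Pow (buchi_states A))"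
  proof clarify
    fix n k j
    assume nin: "unit_graph f n k j \<notin> ?R ` Pow (buchi_states A)"
    show "unit_graph f n k j = {}"
    proof (rule ccontr)
      assume "unit_graph f n k j \<noteq> {}"
      then have kj: "0 \<le> k" "k < 2 ^ n" "0 \<le> j" "j < 2 ^ n"
        by (auto simp: unit_graph_def split: if_splits)
      obtain u v where "range u \<subseteq> binary_digits" "prefix_value u n = k"
        "range v \<subseteq> binary_digits" "prefix_value v n = j"
        using ex_binary_prefix kj by metis
      from unit_graph_eq_residual[OF acc this kj] nin buchi_post_subset[OF A] show False
        by blast
    qed
  qed
  moreover have "finite (insert {} (?R ` Pow (buchi_states A)))"
    using A by (simp add: buchi_automaton_def)
  ultimately show ?thesis
    by (rule finite_subset)
qed

text \<open>
  The unit graphs over a fixed dyadic interval are pairwise disjoint, hence distinct if nonempty.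
  By the intermediate value theorem, an interval on which \<open>f\<close> varies by much would give
  more of them than there are.
\<close>

lemma regular_dyadic_oscillation:
  fixes f :: "real \<Rightarrow> real" and k :: int
  assumes f: "f ` {0..1} \<subseteq> {0..1}" and cont: "continuous_on {0..1} f"
    and fin: "finite {unit_graph f n k j | n k j. True}"
    and k: "0 \<le> k" "k < 2 ^ n"
    and x: "x \<in> {k / 2 ^ n..(k + 1) / 2 ^ n}" and y: "y \<in> {k / 2 ^ n..(k + 1) / 2 ^ n}"
  shows "2 ^ n * f y - 2 ^ n * f x \<le> card {unit_graph f n k j | n k j. True} + 1"
proof -
  let ?I = "{k / 2 ^ n..(k + 1) / 2 ^ n}" and ?U = "{unit_graph f n k j | n k j. True}"
  have "real_of_int (k + 1) \<le> 2 ^ n"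
    using k(2) by (metis of_int_le_iff of_int_numeral of_int_power zless_imp_add1_zle)
  then have I: "?I \<subseteq> {0..1}"
    using k(1) by (auto simp: field_simps)
  \<comment> \<open>These are the levels \<open>j / 2 ^ n\<close> between the two values. Each is
    attained on the interval, which puts a point on the bottom edge of square
    \<open>(k, j)\<close>.\<close>
  let ?J = "{\<lceil>2 ^ n * f x\<rceil>..<\<lceil>2 ^ n * f y\<rceil>}"
  have conn: "connected (f ` ?I)"
    by (rule connected_continuous_image[OF continuous_on_subset[OF cont I]]) simp
  have J: "0 \<le> j \<and> j < 2 ^ n \<and> (\<exists>s. (s, 0) \<in> unit_graph f n k j)" if "j \<in> ?J" for j
  proof -
    have fxy: "2 ^ n * f x \<le> j" "j < 2 ^ n * f y"
      using that by (auto simp: ceiling_le_iff less_ceiling_iff)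
    have "f x \<ge> 0" "f y \<le> 1"
      using f subsetD[OF I x] subsetD[OF I y] by (meson atLeastAtMost_iff image_subset_iff)+
    then have "(0 :: real) \<le> 2 ^ n * f x" "2 ^ n * f y \<le> 2 ^ n"
      by auto
    with fxy have "0 \<le> real_of_int j" "real_of_int j < 2 ^ n"
      by linarith+
    then have "0 \<le> real_of_int j" "real_of_int j < real_of_int (2 ^ n)"
      by simp_all
    then have j: "0 \<le> j" "j < 2 ^ n"
      by (simp_all only: of_int_0_le_iff of_int_less_iff)
    have "j / 2 ^ n \<in> f ` ?I"
      by (rule connectedD_interval[OF conn, of "f x" "f y"])
         (use fxy x y in \<open>auto simp: field_simps\<close>)
    then obtain z where z: "z \<in> ?I" "f z = j / 2 ^ n"
      by auto
    then have "(2 ^ n * z - k, 0) \<in> unit_graph f n k j"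
      using k j by (auto simp: unit_graph_def field_simps)
    with j show ?thesis
      by blast
  qed
  have "inj_on (unit_graph f n k) ?J"
  proof (rule inj_onI)
    fix i j
    assume "i \<in> ?J" "j \<in> ?J" and eq: "unit_graph f n k i = unit_graph f n k j"
    then obtain s where "(s, 0) \<in> unit_graph f n k i" "(s, 0) \<in> unit_graph f n k j"
      using J by metis
    then show "i = j"
      by (auto simp: unit_graph_def split: if_splits)
  qed
  then have "card ?J \<le> card ?U"
    by (rule card_inj_on_le[OF _ _ fin]) blast
  \<comment> \<open>Rounding \<open>2 ^ n * f x\<close> up loses less than one level, whence the
    \<open>+ 1\<close>.\<close>
  then show ?thesis
    by simp linarith
qed

section \<open>Oscillation at dyadic scale\<close>

lemma ex_dyadic_cell:
  fixes x :: real
  assumes "x \<in> {0..1}"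
  obtains k :: int where "0 \<le> k" "k < 2 ^ n" "k \<le> 2 ^ n * x" "2 ^ n * x \<le> real_of_int k + 1"
proof (cases "x = 1")
  case True
  show ?thesis
    \<comment> \<open>The point 1 belongs to the last closed cell; its floor would give an index
      outside the grid.\<close>
    by (rule that[of "2 ^ n - 1"]) (simp_all add: True)
next
  case False
  then have "2 ^ n * x < 2 ^ n"
    using assms by simp
  then have "\<lfloor>2 ^ n * x\<rfloor> < 2 ^ n"
    by (simp add: floor_less_iff)
  moreover have "0 \<le> \<lfloor>2 ^ n * x\<rfloor>"
    using assms by simp
  ultimately show ?thesis
    by (intro that[of "\<lfloor>2 ^ n * x\<rfloor>"]) linarith+
qed

text \<open>Two points at scaled distance at most 1 lie in the same or in adjacent cells. In the
  second case the estimate passes through the common endpoint, which doubles the constant.\<close>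

lemma regular_oscillation:
  fixes f :: "real \<Rightarrow> real"
  assumes f: "f ` {0..1} \<subseteq> {0..1}" and cont: "continuous_on {0..1} f"
    and fin: "finite {unit_graph f n k j | n k j. True}"
    and x: "x \<in> {0..1}" and y: "y \<in> {0..1}" and xy: "\<bar>2 ^ n * x - 2 ^ n * y\<bar> \<le> 1"
  shows "\<bar>2 ^ n * f x - 2 ^ n * f y\<bar> \<le> 2 * (card {unit_graph f n k j | n k j. True} + 1)"
proof -
  let ?C = "real (card {unit_graph f n k j | n k j. True} + 1)"
  have cell: "\<bar>2 ^ n * f x - 2 ^ n * f y\<bar> \<le> ?C"
    if "0 \<le> k" "k < 2 ^ n" "k \<le> 2 ^ n * x" "2 ^ n * x \<le> real_of_int k + 1"
      "k \<le> 2 ^ n * y" "2 ^ n * y \<le> real_of_int k + 1"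
    for k :: int and x y :: real
  proof -
    have "x \<in> {k / 2 ^ n..(k + 1) / 2 ^ n}" "y \<in> {k / 2 ^ n..(k + 1) / 2 ^ n}"
      using that by (auto simp: field_simps)
    from regular_dyadic_oscillation[OF f cont fin that(1,2) this]
      regular_dyadic_oscillation[OF f cont fin that(1,2) this(2,1)]
    show ?thesis
      by simp
  qed
  have main: "\<bar>2 ^ n * f x - 2 ^ n * f y\<bar> \<le> 2 * ?C"
    if x: "x \<in> {0..1}" and y: "y \<in> {0..1}" and xy: "x \<le> y" "2 ^ n * y - 2 ^ n * x \<le> 1" for x y :: real
  proof -
    obtain k :: int where k: "0 \<le> k" "k < 2 ^ n" "k \<le> 2 ^ n * x" "2 ^ n * x \<le> real_of_int k + 1"
      using ex_dyadic_cell[OF x] .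
    have le: "2 ^ n * x \<le> 2 ^ n * y"
      using xy(1) by simp
    show ?thesis
    proof (cases "2 ^ n * y \<le> real_of_int k + 1")
      case True
      with cell[of k x y] k le show ?thesis
        by simp
    next
      case False
      let ?z = "(k + 1) / 2 ^ n"
      have "2 ^ n * y \<le> 2 ^ n"
        using y by simp
      with False have "real_of_int k + 1 < 2 ^ n"
        by linarith
      then have "real_of_int (k + 1) < real_of_int (2 ^ n)"
        by simp
      then have "k + 1 < 2 ^ n"
        by (simp only: of_int_less_iff)
      then have "\<bar>2 ^ n * f x - 2 ^ n * f ?z\<bar> \<le> ?C" "\<bar>2 ^ n * f ?z - 2 ^ n * f y\<bar> \<le> ?C"
        using cell[of k x ?z] cell[of "k + 1" ?z y] k False xy(2) by simp_all
      then show ?thesis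
        by (auto simp: abs_le_iff)
    qed
  qed
  show ?thesis
  proof (cases "x \<le> y")
    case True
    with main[OF x y] xy show ?thesis
      by simp
  next
    case False
    with main[OF y x] xy show ?thesis
      by (simp add: abs_minus_commute)
  qed
qed

text \<open>
  After reading \<open>n\<close> digits with prefix value \<open>k\<close> and writing \<open>n - D\<close> digits with prefix value \<open>i\<close>,
  the transducer for \<open>f\<close> is in state \<open>local_graph f n k (2 ^ D * i)\<close>.
\<close>

definition local_graph :: "(real \<Rightarrow> real) \<Rightarrow> nat \<Rightarrow> int \<Rightarrow> int \<Rightarrow> (real \<times> real) set" where
  "local_graph f n k j =
     {(t, y). \<bar>t\<bar> \<le> 1 \<and> (k + t) / 2 ^ n \<in> {0..1} \<and> y = 2 ^ n * f ((k + t) / 2 ^ n) - j}"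

text \<open>The window around \<open>(k, j)\<close> has bounded width and height, so it is covered
  by unit squares at boundedly many offsets.\<close>

lemma local_graph_eq_union:
  assumes f: "f ` {0..1} \<subseteq> {0..1}" and B: "\<And>t y. (t, y) \<in> local_graph f n k j \<Longrightarrow> \<bar>y\<bar> \<le> B"
  shows "local_graph f n k j = {(t, y). \<bar>t\<bar> \<le> 1 \<and> \<bar>y\<bar> \<le> real_of_int B \<and>
    (\<exists>l \<in> {-2..1}. \<exists>i \<in> {-B - 1..B}. (t - l, y - i) \<in> unit_graph f n (k + l) (j + i))}"
proof (intro set_eqI iffI; clarify)
  fix t y
  assume ty: "(t, y) \<in> local_graph f n k j"
  let ?x = "(k + t) / 2 ^ n"
  have t: "\<bar>t\<bar> \<le> 1" and x: "?x \<in> {0..1}" and y: "y = 2 ^ n * f ?x - j"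
    using ty by (auto simp: local_graph_def)
  have fx: "f ?x \<in> {0..1}"
    using f x by blast
  obtain k' where k': "0 \<le> k'" "k' < 2 ^ n" "k' \<le> 2 ^ n * ?x" "2 ^ n * ?x \<le> real_of_int k' + 1"
    using ex_dyadic_cell[OF x] .
  obtain j' where j': "0 \<le> j'" "j' < 2 ^ n" "j' \<le> 2 ^ n * f ?x" "2 ^ n * f ?x \<le> real_of_int j' + 1"
    using ex_dyadic_cell[OF fx] .
  have "k' - k \<in> {-2..1}"
    \<comment> \<open>The cell of \<open>k + t\<close> starts at most one unit to its left, and
      \<open>t\<close> ranges over \<open>[-1, 1]\<close>, so the offset is at least -2 and at most
      1; likewise for heights below.\<close>
    using k'(3,4) t by (simp) linarith
  moreover have "j' - j \<in> {-B - 1..B}"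
    using j'(3,4) B[OF ty] y by (simp) linarith
  moreover have "(t - (k' - k), y - (j' - j)) \<in> unit_graph f n (k + (k' - k)) (j + (j' - j))"
    using k' j' y by (simp add: unit_graph_def add.commute)
  ultimately show "\<bar>t\<bar> \<le> 1 \<and> \<bar>y\<bar> \<le> real_of_int B \<and>
    (\<exists>l \<in> {-2..1}. \<exists>i \<in> {-B - 1..B}. (t - l, y - i) \<in> unit_graph f n (k + l) (j + i))"
    using t B[OF ty] by (metis of_int_diff)
next
  fix t y :: real and l i :: int
  assume t: "\<bar>t\<bar> \<le> 1" and "(t - l, y - i) \<in> unit_graph f n (k + l) (j + i)"
  then have kl: "0 \<le> k + l" "k + l < 2 ^ n" and s: "0 \<le> t - l" "t - l \<le> 1"
    and y: "f ((k + t) / 2 ^ n) = (j + y) / 2 ^ n"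
    by (auto simp: unit_graph_def split: if_splits)
  have "real_of_int (k + l + 1) \<le> real_of_int (2 ^ n)"
    using kl(2) by (simp only: of_int_le_iff)
  then have "real_of_int k + real_of_int l + 1 \<le> 2 ^ n"
    by simp
  moreover have "0 \<le> real_of_int k + real_of_int l"
    using kl(1) by (simp flip: of_int_add)
  ultimately have "0 \<le> k + t" "k + t \<le> 2 ^ n"
    using s by linarith+
  with t y show "(t, y) \<in> local_graph f n k j"
    by (simp add: local_graph_def)
qed

text \<open>A local graph of bounded height is recovered from the table of unit graphs at its
  offsets; offsets and entries both come from finite sets.\<close>

lemma finite_local_graphs:
  assumes f: "f ` {0..1} \<subseteq> {0..1}" and fin: "finite {unit_graph f n k j | n k j. True}"
  shows "finite {X. \<exists>n k j. X = local_graph f n k j \<and> (\<forall>(t, y) \<in> X. \<bar>y\<bar> \<le> real_of_int B)}"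
proof -
  let ?U = "{unit_graph f n k j | n k j. True}" and ?I = "{-2..1} \<times> {-B - 1..B}"
  let ?\<Phi> = "\<lambda>F. {(t, y). \<bar>t\<bar> \<le> 1 \<and> \<bar>y\<bar> \<le> real_of_int B \<and>
    (\<exists>l \<in> {-2..1}. \<exists>i \<in> {-B - 1..B}. (t - real_of_int l, y - real_of_int i) \<in> F (l, i))}"
  have "{X. \<exists>n k j. X = local_graph f n k j \<and> (\<forall>(t, y) \<in> X. \<bar>y\<bar> \<le> real_of_int B)}
      \<subseteq> ?\<Phi> ` (?I \<rightarrow>\<^sub>E ?U)"
  proof clarify
    fix n k j
    assume B: "\<forall>(t, y) \<in> local_graph f n k j. \<bar>y\<bar> \<le> real_of_int B"
    let ?F = "restrict (\<lambda>(l, i). unit_graph f n (k + l) (j + i)) ?I"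
    have "?F \<in> ?I \<rightarrow>\<^sub>E ?U"
      by auto
    moreover have "local_graph f n k j = ?\<Phi> ?F"
      using B by (subst local_graph_eq_union[OF f, of n k j B]) auto
    ultimately show "local_graph f n k j \<in> ?\<Phi> ` (?I \<rightarrow>\<^sub>E ?U)"
      by blast
  qed
  moreover have "finite (?\<Phi> ` (?I \<rightarrow>\<^sub>E ?U))"
    by (intro finite_imageI finite_PiE fin) simp
  ultimately show ?thesis
    by (rule finite_subset)
qed

text \<open>Points of a window can be at scaled distance 2; going through the midpoint uses
  \<open>regular_oscillation\<close> twice, which explains the factor 4.\<close>

lemma local_graph_oscillation:
  fixes f :: "real \<Rightarrow> real"
  assumes f: "f ` {0..1} \<subseteq> {0..1}" and cont: "continuous_on {0..1} f"
    and fin: "finite {unit_graph f n k j | n k j. True}"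
    and "(t, y) \<in> local_graph f n k j" "(t', y') \<in> local_graph f n k j"
  shows "\<bar>y - y'\<bar> \<le> 4 * (card {unit_graph f n k j | n k j. True} + 1)"
proof -
  let ?x = "(k + t) / 2 ^ n" and ?x' = "(k + t') / 2 ^ n"
  let ?z = "(?x + ?x') / 2"
  have t: "\<bar>t\<bar> \<le> 1" "?x \<in> {0..1}" "y = 2 ^ n * f ?x - j"
    and t': "\<bar>t'\<bar> \<le> 1" "?x' \<in> {0..1}" "y' = 2 ^ n * f ?x' - j"
    using assms(4,5) by (auto simp: local_graph_def)
  have "(a + b) / 2 \<in> {0..1}" if "a \<in> {0..1}" "b \<in> {0..1}" for a b :: real
    using that by auto
  from this[OF t(2) t'(2)] have z: "?z \<in> {0..1}" .
  have eqs: "2 ^ n * ?x = k + t" "2 ^ n * ?x' = k + t'" "2 ^ n * ?z = k + (t + t') / 2"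
    by (simp_all add: field_simps)
  have near: "\<bar>2 ^ n * ?x - 2 ^ n * ?z\<bar> \<le> 1" "\<bar>2 ^ n * ?z - 2 ^ n * ?x'\<bar> \<le> 1"
    unfolding eqs using t(1) t'(1) by (auto simp: abs_le_iff field_simps)
  show ?thesis
    using regular_oscillation[OF f cont fin t(2) z near(1)]
      regular_oscillation[OF f cont fin z t'(2) near(2)]
    unfolding t(3) t'(3) by (auto simp: abs_le_iff)
qed

text \<open>Reading \<open>a\<close> halves the window and recentres it, and writing
  \<open>b\<close> shifts the heights. The result is computed from \<open>X\<close> alone, as a
  finite state does not remember \<open>n\<close>, \<open>k\<close> and \<open>j\<close>.\<close>

definition local_step :: "nat \<Rightarrow> (real \<times> real) set \<Rightarrow> int \<Rightarrow> int \<Rightarrow> (real \<times> real) set" where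
  "local_step D X a b = {(t, y). \<bar>t\<bar> \<le> 1 \<and> ((a + t) / 2, (y + 2 ^ D * b) / 2) \<in> X}"

text \<open>For a signed digit the new window is contained in the old one, so no point of the graph
  is lost.\<close>

lemma local_step_local_graph:
  assumes "a \<in> signed_digits"
  shows "local_step D (local_graph f n k j) a b = local_graph f (Suc n) (2 * k + a) (2 * j + 2 ^ D * b)"
proof -
  have "(real_of_int k + (a + t) / 2) / 2 ^ n = (real_of_int (2 * k + a) + t) / 2 ^ Suc n" for t
    by (simp add: field_simps)
  moreover have "\<bar>(real_of_int a + t) / 2\<bar> \<le> 1" if "\<bar>t\<bar> \<le> 1" for t
    using that assms by (auto simp: signed_digits_def)
  ultimately show ?thesis
    unfolding local_step_def local_graph_def by (auto simp: field_simps)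
qed

text \<open>Before output, doubling brings the heights to at most \<open>2 * 2 ^ D\<close> in
  absolute value. If they all have one sign, the digit 1 or -1 shifts them back into range. If both
  signs occur, the oscillation bound keeps them in range with digit 0.\<close>

lemma ex_signed_output_digit:
  assumes B: "\<And>t y. (t, y) \<in> X \<Longrightarrow> \<bar>y\<bar> \<le> 2 ^ D"
    and osc: "\<And>t y t' y'. (t, y) \<in> local_step D X a 0 \<Longrightarrow> (t', y') \<in> local_step D X a 0 \<Longrightarrow>
      \<bar>y - y'\<bar> \<le> 2 ^ D"
  shows "\<exists>b \<in> signed_digits. \<forall>(t, y) \<in> local_step D X a b. \<bar>y\<bar> \<le> 2 ^ D"
proof -
  let ?Y = "local_step D X a 0"
  have Y: "\<bar>y\<bar> \<le> 2 * 2 ^ D" if "(t, y) \<in> ?Y" for t y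
    using that B by (force simp: local_step_def)
  have shift: "(t, y) \<in> local_step D X a b \<Longrightarrow> (t, y + 2 ^ D * b) \<in> ?Y" for t y b
    by (simp add: local_step_def)
  consider "\<forall>(t, y) \<in> ?Y. y \<ge> 0" | "\<forall>(t, y) \<in> ?Y. y \<le> 0"
    | t0 y0 t1 y1 where "(t0, y0) \<in> ?Y" "y0 < 0" "(t1, y1) \<in> ?Y" "y1 > 0"
    by (force simp: not_le)
  then show ?thesis
  proof cases
    case 1
    then have "\<forall>(t, y) \<in> local_step D X a 1. \<bar>y\<bar> \<le> 2 ^ D"
      using shift[of _ _ 1] Y by fastforce
    then show ?thesis
      by (intro bexI[of _ 1]) (auto simp: signed_digits_def)
  next
    case 2
    then have "\<forall>(t, y) \<in> local_step D X a (-1). \<bar>y\<bar> \<le> 2 ^ D"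
      using shift[of _ _ "-1"] Y by fastforce
    then show ?thesis
      by (intro bexI[of _ "-1"]) (auto simp: signed_digits_def)
  next
    case 3
    then have "\<forall>(t, y) \<in> ?Y. \<bar>y\<bar> \<le> 2 ^ D"
      using osc[of _ _ t0 y0] osc[of _ _ t1 y1] by fastforce
    then show ?thesis
      by (intro bexI[of _ 0]) (auto simp: signed_digits_def)
  qed
qed

section \<open>The deterministic signed transducer\<close>

definition oscillation_bound :: "(real \<Rightarrow> real) \<Rightarrow> nat \<Rightarrow> bool" where
  "oscillation_bound f D \<longleftrightarrow> (\<forall>n k j t y t' y'. (t, y) \<in> local_graph f n k j \<longrightarrow>
     (t', y') \<in> local_graph f n k j \<longrightarrow> \<bar>y - y'\<bar> \<le> 2 ^ D)"

definition output_digit :: "nat \<Rightarrow> (real \<times> real) set \<Rightarrow> int \<Rightarrow> int" where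
  "output_digit D X a =
     (SOME b. b \<in> signed_digits \<and> (\<forall>(t, y) \<in> local_step D X a b. \<bar>y\<bar> \<le> 2 ^ D))"

text \<open>The first component counts the delay. While it is below \<open>D\<close>, nothing has
  been written, and recording \<open>n = i\<close> and \<open>j = 0\<close> makes the height bound
  follow from values of \<open>f\<close> being at most 1.\<close>

definition local_graph_states :: "(real \<Rightarrow> real) \<Rightarrow> nat \<Rightarrow> (nat \<times> (real \<times> real) set) set" where
  "local_graph_states f D = {(i, X). i \<le> D \<and> (\<forall>(t, y) \<in> X. \<bar>y\<bar> \<le> 2 ^ D) \<and>
     (\<exists>n k j. X = local_graph f n k j \<and> (i < D \<longrightarrow> n = i \<and> j = 0))}"

fun local_graph_next ::
  "nat \<Rightarrow> nat \<times> (real \<times> real) set \<Rightarrow> int \<Rightarrow> int option \<times> nat \<times> (real \<times> real) set" where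
  "local_graph_next D (i, X) a =
     (if i < D then (None, Suc i, local_step D X a 0)
      else (Some (output_digit D X a), i, local_step D X a (output_digit D X a)))"

definition local_graph_transducer ::
  "(real \<Rightarrow> real) \<Rightarrow> nat \<Rightarrow> (nat \<times> (real \<times> real) set, int) transducer" where
  "local_graph_transducer f D = \<lparr>td_states = local_graph_states f D,
     td_initial = (0, local_graph f 0 0 0),
     td_trans = {(q, a, w, q'). q \<in> local_graph_states f D \<and> a \<in> signed_digits \<and>
       (w, q') = local_graph_next D q a}\<rparr>"

lemma output_digit:
  assumes osc: "oscillation_bound f D"
    and X: "(i, X) \<in> local_graph_states f D" and a: "a \<in> signed_digits"
  shows "output_digit D X a \<in> signed_digits"
    and "\<forall>(t, y) \<in> local_step D X a (output_digit D X a). \<bar>y\<bar> \<le> 2 ^ D"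
proof -
  obtain n k j where X': "X = local_graph f n k j" "\<forall>(t, y) \<in> X. \<bar>y\<bar> \<le> 2 ^ D"
    using X by (auto simp: local_graph_states_def)
  have "\<exists>b \<in> signed_digits. \<forall>(t, y) \<in> local_step D X a b. \<bar>y\<bar> \<le> 2 ^ D"
  proof (rule ex_signed_output_digit)
    show "\<bar>y - y'\<bar> \<le> 2 ^ D"
      if "(t, y) \<in> local_step D X a 0" "(t', y') \<in> local_step D X a 0" for t y t' y'
      using that osc unfolding X' local_step_local_graph[OF a] oscillation_bound_def by blast
  qed (use X'(2) in blast)
  then have "\<exists>b. b \<in> signed_digits \<and> (\<forall>(t, y) \<in> local_step D X a b. \<bar>y\<bar> \<le> 2 ^ D)"
    by blast
  from someI_ex[OF this]
  show "output_digit D X a \<in> signed_digits"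
    "\<forall>(t, y) \<in> local_step D X a (output_digit D X a). \<bar>y\<bar> \<le> 2 ^ D"
    unfolding output_digit_def by blast+
qed

lemma local_graph_no_output_bound:
  assumes f: "f ` {0..1} \<subseteq> {0..1}" and "n \<le> D" "(t, y) \<in> local_graph f n k 0"
  shows "\<bar>y\<bar> \<le> 2 ^ D"
proof -
  let ?x = "(k + t) / 2 ^ n"
  have y: "y = 2 ^ n * f ?x" and "?x \<in> {0..1}"
    using assms(3) by (auto simp: local_graph_def)
  then have fx: "f ?x \<in> {0..1}"
    using f by blast
  have "2 ^ n * f ?x \<le> 2 ^ D * 1"
    using fx \<open>n \<le> D\<close> by (intro mult_mono power_increasing) auto
  moreover have "0 \<le> 2 ^ n * f ?x"
    using fx by simp
  ultimately show ?thesis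
    unfolding y by simp
qed

lemma local_graph_next_closed:
  assumes f: "f ` {0..1} \<subseteq> {0..1}"
    and osc: "oscillation_bound f D"
    and q: "q \<in> local_graph_states f D" and a: "a \<in> signed_digits"
  shows "fst (local_graph_next D q a) \<in> insert None (Some ` signed_digits)"
    and "snd (local_graph_next D q a) \<in> local_graph_states f D"
proof -
  obtain i X where iX: "q = (i, X)"
    by (cases q)
  obtain n k j where X: "X = local_graph f n k j" "i < D \<longrightarrow> n = i \<and> j = 0" and i: "i \<le> D"
    using q by (auto simp: local_graph_states_def iX)
  note out = output_digit[OF osc q[unfolded iX] a]
  show "fst (local_graph_next D q a) \<in> insert None (Some ` signed_digits)"
    using out(1) by (auto simp: iX)
  show "snd (local_graph_next D q a) \<in> local_graph_states f D"
  proof (cases "i < D")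
    case True
    then have step: "local_step D X a 0 = local_graph f (Suc i) (2 * k + a) 0"
      using X by (simp add: local_step_local_graph[OF a])
    moreover have "\<forall>(t, y) \<in> local_step D X a 0. \<bar>y\<bar> \<le> 2 ^ D"
      unfolding step using local_graph_no_output_bound[OF f, of "Suc i" D] True by auto
    ultimately show ?thesis
      using True unfolding local_graph_states_def iX by auto
  next
    case False
    let ?b = "output_digit D X a"
    have "local_step D X a ?b = local_graph f (Suc n) (2 * k + a) (2 * j + 2 ^ D * ?b)"
      unfolding X(1) by (rule local_step_local_graph[OF a])
    with out(2) have "(D, local_step D X a ?b) \<in> local_graph_states f D"
      unfolding local_graph_states_def by blast
    with False i show ?thesis
      by (simp add: iX)
  qed
qed

lemma local_graph_initial:
  assumes f: "f ` {0..1} \<subseteq> {0..1}"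
  shows "(0, local_graph f 0 0 0) \<in> local_graph_states f D"
  using local_graph_no_output_bound[OF f, of 0 D] by (auto simp: local_graph_states_def)

lemma local_graph_transducer_transD:
  assumes "(q, a, w, q') \<in> td_trans (local_graph_transducer f D)"
  shows "q \<in> local_graph_states f D" "a \<in> signed_digits" "local_graph_next D q a = (w, q')"
  using assms by (simp_all add: local_graph_transducer_def del: local_graph_next.simps)

lemma local_graph_transducer_phase:
  assumes "q 0 = td_initial (local_graph_transducer f D)"
    and "\<And>i. i < n \<Longrightarrow> (q i, \<alpha> i, w i, q (Suc i)) \<in> td_trans (local_graph_transducer f D)"
  shows "fst (q n) = min n D"
  using assms(2)
proof (induction n)
  case (Suc n)
  have "fst (q n) = min n D"
    using Suc by simp
  moreover have "local_graph_next D (q n) (\<alpha> n) = (w n, q (Suc n))"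
    using Suc.prems by (intro local_graph_transducer_transD(3)[where f = f]) simp
  ultimately show ?case
    by (cases "q n"; cases "q (Suc n)") (auto split: if_splits)
qed (simp add: assms(1) local_graph_transducer_def)

lemma local_graph_transducer_with_delay:
  assumes f: "f ` {0..1} \<subseteq> {0..1}"
    and osc: "oscillation_bound f D"
    and fin: "finite {unit_graph f n k j | n k j. True}"
  shows "transducer_with_delay signed_digits D (local_graph_transducer f D)"
  unfolding transducer_with_delay_def
proof (intro conjI allI impI)
  have "local_graph_states f D \<subseteq> {..D} \<times>
      {X. \<exists>n k j. X = local_graph f n k j \<and> (\<forall>(t, y) \<in> X. \<bar>y\<bar> \<le> real_of_int (2 ^ D))}"
    by (auto simp: local_graph_states_def)
  then show "finite (td_states (local_graph_transducer f D))"
    using finite_local_graphs[OF f fin, of "2 ^ D"]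
    by (auto simp: local_graph_transducer_def intro: finite_subset)
  show "td_initial (local_graph_transducer f D) \<in> td_states (local_graph_transducer f D)"
    using local_graph_initial[OF f] by (simp add: local_graph_transducer_def)
  show "td_trans (local_graph_transducer f D) \<subseteq> td_states (local_graph_transducer f D) \<times> signed_digits \<times>
      insert None (Some ` signed_digits) \<times> td_states (local_graph_transducer f D)"
  proof (rule subsetI)
    fix p
    assume p: "p \<in> td_trans (local_graph_transducer f D)"
    obtain q a w q' where p_eq: "p = (q, a, w, q')"
      by (cases p)
    note qa = local_graph_transducer_transD[OF p[unfolded p_eq]]
    from local_graph_next_closed[OF f osc qa(1,2)] qa
    show "p \<in> td_states (local_graph_transducer f D) \<times> signed_digits \<times>
      insert None (Some ` signed_digits) \<times> td_states (local_graph_transducer f D)"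
      by (simp add: p_eq local_graph_transducer_def)
  qed
  fix q \<alpha> w and n :: nat
  assume q: "q 0 = td_initial (local_graph_transducer f D)"
    "\<forall>i\<le>n. (q i, \<alpha> i, w i, q (Suc i)) \<in> td_trans (local_graph_transducer f D)"
  then have "fst (q n) = min n D"
    by (intro local_graph_transducer_phase[of q f D n \<alpha> w]) simp_all
  moreover have "local_graph_next D (q n) (\<alpha> n) = (w n, q (Suc n))"
    using q(2) by (intro local_graph_transducer_transD(3)[where f = f]) simp
  ultimately show "w n = None \<longleftrightarrow> n < D"
    by (cases "q n") (auto split: if_splits)
qed

lemma local_graph_transducer_deterministic:
  "deterministic_transducer signed_digits (local_graph_transducer f D)"
  unfolding deterministic_transducer_def
proof (intro ballI)
  fix q a
  assume "q \<in> td_states (local_graph_transducer f D)" "a \<in> signed_digits"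
  then show "\<exists>!p. (q, a, fst p, snd p) \<in> td_trans (local_graph_transducer f D)"
    by (intro ex1I[of _ "local_graph_next D q a"])
       (simp_all add: local_graph_transducer_def del: local_graph_next.simps)
qed

text \<open>The true point and its value, rescaled, always belong to the current state, so the
  height bound of states limits the error of the output.\<close>

lemma local_graph_transducer_computes:
  assumes f: "f ` {0..1} \<subseteq> {0..1}"
    and osc: "oscillation_bound f D"
  shows "computes signed_digits D (local_graph_transducer f D) f"
  unfolding computes_def
proof (intro ballI allI impI conjI)
  fix x :: real and \<alpha>
  assume "x \<in> {0..1}" "represents signed_digits \<alpha> x"
  then have \<alpha>: "\<alpha> n \<in> signed_digits" for n
    by (auto simp: represents_def)
  define q where "q = rec_nat (0, local_graph f 0 0 0) (\<lambda>n q. snd (local_graph_next D q (\<alpha> n)))"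
  have q0: "q 0 = (0, local_graph f 0 0 0)"
    and q_Suc: "q (Suc n) = snd (local_graph_next D (q n) (\<alpha> n))" for n
    by (simp_all add: q_def)
  have "q n \<in> local_graph_states f D" for n
  proof (induction n)
    case (Suc n)
    show ?case
      unfolding q_Suc by (rule local_graph_next_closed(2)[OF f osc Suc \<alpha>])
  qed (simp add: q0 local_graph_initial[OF f])
  then have "transducer_run (local_graph_transducer f D) \<alpha> q (\<lambda>n. fst (local_graph_next D (q n) (\<alpha> n)))"
    using \<alpha> by (simp add: transducer_run_def local_graph_transducer_def q0 q_Suc del: local_graph_next.simps)
  then show "\<exists>q w. transducer_run (local_graph_transducer f D) \<alpha> q w"
    by blast
next
  fix x :: real and \<alpha> q w
  assume x: "x \<in> {0..1}" and \<alpha>: "represents signed_digits \<alpha> x"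
    and run: "transducer_run (local_graph_transducer f D) \<alpha> q w"
  have q0: "q 0 = td_initial (local_graph_transducer f D)"
    and trans: "(q n, \<alpha> n, w n, q (Suc n)) \<in> td_trans (local_graph_transducer f D)" for n
    using run by (simp_all add: transducer_run_def)
  have \<alpha>n: "\<alpha> n \<in> signed_digits" for n
    using \<alpha> by (auto simp: represents_def)
  have q: "q n \<in> local_graph_states f D" "local_graph_next D (q n) (\<alpha> n) = (w n, q (Suc n))" for n
    using local_graph_transducer_transD[OF trans[of n]] by simp_all
  have phase: "fst (q n) = min n D" for n
    using local_graph_transducer_phase[of q f D n \<alpha> w] q0 trans by blast
  define X where "X n = snd (q n)" for n
  have qX: "q n = (min n D, X n)" for n
    using phase[of n] by (simp add: X_def prod_eq_iff)
  have early: "w n = None \<and> X (Suc n) = local_step D (X n) (\<alpha> n) 0" if "n < D" for n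
    using q(2)[of n] that by (simp add: qX)
  have late: "w n = Some (output_digit D (X n) (\<alpha> n)) \<and>
      X (Suc n) = local_step D (X n) (\<alpha> n) (output_digit D (X n) (\<alpha> n))" if "\<not> n < D" for n
    using q(2)[of n] that by (simp add: qX)
  define \<beta> where "\<beta> n = output_digit D (X (D + n)) (\<alpha> (D + n))" for n
  have w: "writes D w \<beta>"
    using early late by (simp add: writes_def \<beta>_def)
  have \<beta>: "range \<beta> \<subseteq> signed_digits"
    using output_digit(1)[OF osc q(1)[unfolded qX] \<alpha>n] by (auto simp: \<beta>_def)
  \<comment> \<open>The invariant: the index of the output prefix lags by \<open>D\<close>, and
    truncated subtraction makes it empty during the delay.\<close>
  have X: "X n = local_graph f n (prefix_value \<alpha> n) (2 ^ D * prefix_value \<beta> (n - D))" for n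
  proof (induction n)
    case 0
    then show ?case
      using q0 by (simp add: X_def local_graph_transducer_def)
  next
    case (Suc n)
    show ?case
    proof (cases "n < D")
      case True
      with early[OF True] Suc show ?thesis
        by (simp add: local_step_local_graph[OF \<alpha>n])
    next
      case False
      then have "Suc n - D = Suc (n - D)" "\<beta> (n - D) = output_digit D (X n) (\<alpha> n)"
        by (simp_all add: \<beta>_def Suc_diff_le)
      with late[OF False] Suc show ?thesis
        by (simp add: local_step_local_graph[OF \<alpha>n] algebra_simps)
    qed
  qed
  have "word_value \<beta> = f x"
  proof (rule word_value_eqI[OF \<beta>])
    fix m
    let ?n = "D + m"
    let ?t = "2 ^ ?n * x - prefix_value \<alpha> ?n" and ?y = "2 ^ ?n * f x - 2 ^ D * prefix_value \<beta> m"
    have "\<bar>?t\<bar> \<le> 1"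
      using prefix_value_approx[of \<alpha> ?n] \<alpha> by (simp add: represents_def)
    then have "(?t, ?y) \<in> X ?n"
      using x by (simp add: X local_graph_def)
    then have "\<bar>?y\<bar> \<le> 2 ^ D"
      using q(1)[of ?n] by (auto simp: qX local_graph_states_def)
    \<comment> \<open>Dividing the height bound \<open>2 ^ D\<close> by the factor due to the lag
      leaves an error of at most 1.\<close>
    moreover have "?y = 2 ^ D * (2 ^ m * f x - prefix_value \<beta> m)"
      by (simp add: power_add algebra_simps)
    ultimately show "\<bar>2 ^ m * f x - prefix_value \<beta> m\<bar> \<le> 1"
      by (simp add: abs_mult)
  qed
  with w \<beta> show "\<exists>\<beta>. writes D w \<beta> \<and> represents signed_digits \<beta> (f x)"
    by (auto simp: represents_def)
qed

lemma continuous_regular_imp_det_signed: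
  assumes f: "f ` {0..1} \<subseteq> {0..1}" and cont: "continuous_on {0..1} f"
    and reg: "regular_function f"
  shows "det_computable signed_digits f"
proof -
  note fin = finite_unit_graphs[OF reg]
  \<comment> \<open>This is the oscillation bound for local graphs; a delay \<open>D\<close> with
    \<open>2 ^ D\<close> above it always leaves a valid output digit.\<close>
  let ?C = "real (4 * (card {unit_graph f n k j | n k j. True} + 1))"
  obtain D where D: "?C < 2 ^ D"
    using real_arch_pow[of 2 ?C] by auto
  have "\<bar>y - y'\<bar> \<le> 2 ^ D"
    if "(t, y) \<in> local_graph f n k j" "(t', y') \<in> local_graph f n k j" for n k j t y t' y'
    using local_graph_oscillation[OF f cont fin that] D by linarith
  then have osc: "oscillation_bound f D"
    unfolding oscillation_bound_def by blast
  show ?thesis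
    using local_graph_transducer_with_delay[OF f osc fin] local_graph_transducer_deterministic
      local_graph_transducer_computes[OF f osc] by (rule det_computableI)
qed

theorem theorem3p1:
  fixes f :: "real \<Rightarrow> real"
  assumes "f ` {0..1} \<subseteq> {0..1}"
  shows "((continuous_on {0..1} f \<and> regular_function f) \<longleftrightarrow> nondet_computable binary_digits f) \<and>
         (nondet_computable binary_digits f \<longleftrightarrow> det_computable signed_digits f)"
  using continuous_regular_imp_det_signed[OF assms] det_signed_imp_nondet_binary[OF _ assms]
    nondet_binary_imp_continuous_regular[OF _ assms] by blast

end
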